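(* Let $G$ be a finite simple graph with maximum degree $\Delta\ge 6$. If $\mathrm{mad}(G)<2+\frac{4\Delta-8}{5\Delta+2}$, then $\chi_\ell^i(G)=\Delta$. In particular, if $G$ is planar (with maximum degree $\Delta\ge 6$) and has girth $g\ge 7+\frac{12}{\Delta-2}$, then $\chi_\ell^i(G)=\Delta$.
   Context: Graphs are finite and simple. The maximum average degree is $\mathrm{mad}(G)=\max_{H\subseteq G}\frac{2|E(H)|}{|V(H)|}$, the maximum over all (nonempty) subgraphs $H$ of $G$. An injective coloring of $G$ is an assignment of colors to the vertices of $G$ such that any two distinct vertices with a common neighbor receive different colors (it need not be proper, i.e. adjacent vertices may receive the same color). A list-assignment $L$ gives each vertex $v$ a set $L(v)$ of colors. The injective choice number $\chi_\ell^i(G)$ is the minimum $k$ such that, for every list-assignment $L$ with $|L(v)|\ge k$ for every vertex $v$, the graph $G$ has an injective coloring in which each vertex $v$ receives a color from $L(v)$. *)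

theory Defs
  imports "HOL-Analysis.Analysis"
begin

definition simple_graph :: "'a set \<Rightarrow> 'a set set \<Rightarrow> bool" where
  "simple_graph V E \<longleftrightarrow> finite V \<and> (\<forall>e\<in>E. e \<subseteq> V \<and> card e = 2)"

definition vertex_degree :: "'a set set \<Rightarrow> 'a \<Rightarrow> nat" where
  "vertex_degree E v = card {e \<in> E. v \<in> e}"

text \<open>The 0 only matters for the graph without vertices, since \<^term>\<open>Max {}\<close> is unspecified.\<close>

definition max_degree :: "'a set \<Rightarrow> 'a set set \<Rightarrow> nat" where
  "max_degree V E = Max (insert 0 (vertex_degree E ` V))"

definition subgraph_of :: "'a set \<Rightarrow> 'a set set \<Rightarrow> 'a set \<Rightarrow> 'a set set \<Rightarrow> bool" where
  "subgraph_of W F V E \<longleftrightarrow> W \<subseteq> V \<and> F \<subseteq> E \<and> (\<forall>e\<in>F. e \<subseteq> W)"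

text \<open>Meaningful only for finite graphs with at least one vertex.\<close>

definition mad :: "'a set \<Rightarrow> 'a set set \<Rightarrow> real" where
  "mad V E = Max {2 * real (card F) / real (card W) | W F. subgraph_of W F V E \<and> W \<noteq> {}}"

definition injective_coloring :: "'a set \<Rightarrow> 'a set set \<Rightarrow> ('a \<Rightarrow> 'c) \<Rightarrow> bool" where
  "injective_coloring V E f \<longleftrightarrow>
     (\<forall>u\<in>V. \<forall>v\<in>V. u \<noteq> v \<and> (\<exists>w\<in>V. {u, w} \<in> E \<and> {v, w} \<in> E) \<longrightarrow> f u \<noteq> f v)"

text \<open>Colors are natural numbers, which is no restriction for a finite graph: lists can be
  shrunk to finite ones, and then only finitely many colors occur. Infinite lists are admitted
  explicitly because \<open>card\<close> is 0 on them.\<close>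

definition injectively_choosable :: "'a set \<Rightarrow> 'a set set \<Rightarrow> nat \<Rightarrow> bool" where
  "injectively_choosable V E k \<longleftrightarrow>
     (\<forall>L :: 'a \<Rightarrow> nat set. (\<forall>v\<in>V. infinite (L v) \<or> k \<le> card (L v)) \<longrightarrow>
        (\<exists>f. injective_coloring V E f \<and> (\<forall>v\<in>V. f v \<in> L v)))"

definition injective_choice_number :: "'a set \<Rightarrow> 'a set set \<Rightarrow> nat" where
  "injective_choice_number V E = (LEAST k. injectively_choosable V E k)"

definition graph_cycle :: "'a set \<Rightarrow> 'a set set \<Rightarrow> 'a list \<Rightarrow> bool" where
  "graph_cycle V E vs \<longleftrightarrow> 3 \<le> length vs \<and> distinct vs \<and> set vs \<subseteq> V \<and>
     (\<forall>i < length vs. {vs ! i, vs ! (Suc i mod length vs)} \<in> E)"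

text \<open>An acyclic graph has girth \<open>\<infinity>\<close>.\<close>

definition girth :: "'a set \<Rightarrow> 'a set set \<Rightarrow> enat" where
  "girth V E = (INF vs \<in> {vs. graph_cycle V E vs}. enat (length vs))"

text \<open>A drawing without crossings in the Euclidean plane, here \<^typ>\<open>complex\<close>: vertices go to
  distinct points, an edge to a simple arc joining the images of its ends and passing through no
  other vertex, and two arcs meet only in images of common ends.\<close>

definition plane_embedding ::
    "'a set \<Rightarrow> 'a set set \<Rightarrow> ('a \<Rightarrow> complex) \<Rightarrow> ('a set \<Rightarrow> real \<Rightarrow> complex) \<Rightarrow> bool" where
  "plane_embedding V E p \<gamma> \<longleftrightarrow>
     inj_on p V \<and>
     (\<forall>e\<in>E. arc (\<gamma> e) \<and> {pathstart (\<gamma> e), pathfinish (\<gamma> e)} = p ` e \<and>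
             path_image (\<gamma> e) \<inter> p ` V = p ` e) \<and>
     (\<forall>e\<in>E. \<forall>e'\<in>E. e \<noteq> e' \<longrightarrow> path_image (\<gamma> e) \<inter> path_image (\<gamma> e') \<subseteq> p ` (e \<inter> e'))"

definition planar_graph :: "'a set \<Rightarrow> 'a set set \<Rightarrow> bool" where
  "planar_graph V E \<longleftrightarrow> (\<exists>p \<gamma>. plane_embedding V E p \<gamma>)"

end

theory Submission imports Defs begin

text \<open>Sparsity: take a minimal graph that cannot be colored from the lists. Deleting an edge
  creates conflicts only at its two ends, so no edge joins two \<^emph>\<open>light\<close> vertices, a vertex being
  light if it has fewer than \<open>\<Delta>\<close> conflicts. Threads of three 2-vertices necessarily join
  \<open>\<Delta>\<close>-vertices; a closed chain of such threads is reducible because even cycles are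
  2-choosable, so there are at most as many of these threads as \<open>\<Delta>\<close>-vertices.
  Discharging then contradicts the bound on the average degree.

  Planarity: by Janiszewski's theorem an edge on a cycle is incident with at most two faces and an
  acyclic drawing does not separate the plane, so every face boundary contains a cycle; by the Jordan
  curve theorem every edge outside a maximal forest adds a face. Counting incidences between edges
  and faces gives the sparsity needed above.\<close>

section \<open>Forests and cycles\<close>

text \<open>The obstacle is that discharging cannot stay local: the middle of a thread of three
  2-vertices remains short by \<open>p\<close> after its ends have passed on all they can. Every
  \<open>\<Delta>\<close>-vertex therefore pays \<open>p\<close> into a common pool, and only the
  total numbers of such threads and of \<open>\<Delta>\<close>-vertices have to be compared. For
  this comparison the threads are read as edges of a multigraph on the
  \<open>\<Delta>\<close>-vertices. More edges than vertices force a cycle, and along it the thread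
  ends form an even cycle of conflicts in which each end keeps two free colors. The constants come
  from tight cases: a 3-vertex with two 2-neighbors and one \<open>\<Delta>\<close>-neighbor, a
  4-vertex with two 2-neighbors and two 3-neighbors, and the \<open>\<Delta>\<close>-vertex itself
  can all end with charge exactly 0. The assumption \<open>\<Delta> \<ge> 6\<close> enters the
  charge estimates as \<open>4 * s \<le> a\<close>. On the topological side a face is represented by
  a point in it, so that counting faces means collecting points that are pairwise separated by the
  drawing.\<close>

definition reach :: "'a set set \<Rightarrow> ('a \<times> 'a) set" where
  "reach F = {(x, y). {x, y} \<in> F}\<^sup>*"

text \<open>Every edge is a bridge. This form suits inductions that split a forest at an edge; an
  explicit cycle is extracted only when the condition fails.\<close>

definition acyclic_edges :: "'a set set \<Rightarrow> bool" where
  "acyclic_edges F \<longleftrightarrow> (\<forall>x y. {x, y} \<in> F \<longrightarrow> (x, y) \<notin> reach (F - {{x, y}}))"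

fun path_edges :: "'a list \<Rightarrow> 'a set set" where
  "path_edges (x # y # zs) = insert {x, y} (path_edges (y # zs))"
| "path_edges _ = {}"

lemma reach_mono: "F \<subseteq> G \<Longrightarrow> reach F \<subseteq> reach G"
  unfolding reach_def by (rule rtrancl_mono) auto

lemma reach_refl [simp]: "(x, x) \<in> reach F"
  by (simp add: reach_def)

lemma reach_trans: "(x, y) \<in> reach F \<Longrightarrow> (y, z) \<in> reach F \<Longrightarrow> (x, z) \<in> reach F"
  unfolding reach_def by (rule rtrancl_trans)

lemma reach_edge: "{x, y} \<in> F \<Longrightarrow> (x, y) \<in> reach F"
  unfolding reach_def by auto

lemma reach_sym: "(x, y) \<in> reach F \<Longrightarrow> (y, x) \<in> reach F"
proof -
  have "sym {(x, y). {x, y} \<in> F}"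
    by (auto simp: sym_def insert_commute)
  then show "(x, y) \<in> reach F \<Longrightarrow> (y, x) \<in> reach F"
    unfolding reach_def using sym_rtrancl symD by metis
qed

lemma reach_insert:
  assumes "(u, v) \<in> reach (insert {x, y} F)"
  shows "(u, v) \<in> reach F \<or> (u, x) \<in> reach F \<and> (y, v) \<in> reach F
           \<or> (u, y) \<in> reach F \<and> (x, v) \<in> reach F"
  using assms unfolding reach_def [of "insert {x, y} F"]
proof (induction rule: rtrancl_induct)
  case base
  then show ?case by simp
next
  case (step v w)
  consider "{v, w} \<in> F" | "v = x \<and> w = y" | "v = y \<and> w = x"
    using step.hyps by (auto simp: doubleton_eq_iff)
  then show ?case
  proof cases
    case 1
    then show ?thesis using step.IH reach_trans reach_edge by metis
  next
    case 2
    then show ?thesis using step.IH reach_refl by metis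
  next
    case 3
    then show ?thesis using step.IH reach_refl by metis
  qed
qed

lemma acyclic_edges_subset: "acyclic_edges G \<Longrightarrow> F \<subseteq> G \<Longrightarrow> acyclic_edges F"
  unfolding acyclic_edges_def using reach_mono by (metis Diff_mono order_refl subsetD)

text \<open>A detour around an old edge \<open>{u, v}\<close> would have to use the new edge, and
  closing it up with \<open>{u, v}\<close> would already join \<open>x\<close> to \<open>y\<close>
  inside \<open>F\<close>.\<close>

lemma acyclic_edges_insert:
  assumes "acyclic_edges F" "(x, y) \<notin> reach F"
  shows "acyclic_edges (insert {x, y} F)"
  unfolding acyclic_edges_def
proof (intro allI impI notI)
  fix u v assume uv: "{u, v} \<in> insert {x, y} F"
    and r: "(u, v) \<in> reach (insert {x, y} F - {{u, v}})"
  show False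
  proof (cases "{u, v} = {x, y}")
    case True
    then have "(u, v) \<in> reach F" using r reach_mono by (metis Diff_subset_conv insert_is_Un order_refl subsetD)
    then have "(x, y) \<in> reach F"
      using True reach_sym by (metis doubleton_eq_iff)
    then show False using assms by simp
  next
    case False
    then have "(u, v) \<in> reach (insert {x, y} (F - {{u, v}}))" "{u, v} \<in> F"
      using r uv by (auto simp: insert_Diff_if)
    moreover have "(u, v) \<notin> reach (F - {{u, v}})"
      using assms \<open>{u, v} \<in> F\<close> by (auto simp: acyclic_edges_def)
    ultimately have "(u, x) \<in> reach (F - {{u, v}}) \<and> (y, v) \<in> reach (F - {{u, v}}) \<or>
        (u, y) \<in> reach (F - {{u, v}}) \<and> (x, v) \<in> reach (F - {{u, v}})"
      using reach_insert by metis
    then have "(u, x) \<in> reach F \<and> (y, v) \<in> reach F \<or> (u, y) \<in> reach F \<and> (x, v) \<in> reach F"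
      using reach_mono [of "F - {{u, v}}" F] by blast
    moreover have "(u, v) \<in> reach F" using \<open>{u, v} \<in> F\<close> by (rule reach_edge)
    ultimately have "(x, y) \<in> reach F" by (meson reach_sym reach_trans)
    then show False using assms by simp
  qed
qed

lemma maximal_acyclic:
  assumes "finite E"
  obtains F where "F \<subseteq> E" "acyclic_edges F" "\<And>x y. {x, y} \<in> E \<Longrightarrow> (x, y) \<in> reach F"
proof -
  have "finite {F. F \<subseteq> E \<and> acyclic_edges F}" "{} \<in> {F. F \<subseteq> E \<and> acyclic_edges F}"
    using assms by (auto simp: acyclic_edges_def)
  from finite_has_maximal2 [OF this] obtain F where F: "F \<subseteq> E" "acyclic_edges F"
    and mx: "\<And>G. G \<subseteq> E \<Longrightarrow> acyclic_edges G \<Longrightarrow> F \<subseteq> G \<Longrightarrow> F = G"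
    by auto
  have "(x, y) \<in> reach F" if "{x, y} \<in> E" for x y
  proof (rule ccontr)
    assume n: "(x, y) \<notin> reach F"
    then have "acyclic_edges (insert {x, y} F)" using F acyclic_edges_insert by metis
    then have "F = insert {x, y} F" using mx F that by blast
    then show False using n reach_edge by (metis insertI1)
  qed
  then show thesis using that F by blast
qed

text \<open>\<open>F1\<close> is what remains joined to \<open>x\<close> after the deletion and
  \<open>F2\<close> is all the rest, possibly more than the component of \<open>y\<close>. The
  reachability claims serve to partition the vertices, the disjointness claims serve the induction
  on drawings.\<close>

lemma acyclic_split:
  assumes "acyclic_edges F" "{x, y} \<in> F" and card2: "\<forall>e\<in>F. card e = 2"
  obtains F1 F2 where "F = insert {x, y} (F1 \<union> F2)" "{x, y} \<notin> F1" "{x, y} \<notin> F2"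
    "F1 \<inter> F2 = {}" "y \<notin> \<Union>F1" "x \<notin> \<Union>F2" "\<Union>F1 \<inter> \<Union>F2 = {}"
    "\<And>v. v \<in> \<Union>F1 \<Longrightarrow> (x, v) \<in> reach (F - {{x, y}})"
    "\<And>v. v \<in> \<Union>F2 \<Longrightarrow> (x, v) \<notin> reach (F - {{x, y}})"
proof -
  let ?R = "reach (F - {{x, y}})"
  have all: "(x, w) \<in> ?R" if "e \<in> F - {{x, y}}" "v \<in> e" "(x, v) \<in> ?R" "w \<in> e" for e v w
  proof (cases "v = w")
    case False
    moreover have "card e = 2" using that card2 by auto
    ultimately have "e = {v, w}" using that by (auto simp: card_2_iff)
    then show ?thesis using that by (metis reach_edge reach_trans)
  qed (use that in auto)
  have nxy: "(x, y) \<notin> ?R" using assms by (auto simp: acyclic_edges_def)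
  define F1 where "F1 = {e \<in> F - {{x, y}}. \<exists>v\<in>e. (x, v) \<in> ?R}"
  define F2 where "F2 = F - {{x, y}} - F1"
  show thesis
  proof
    show "F = insert {x, y} (F1 \<union> F2)" "{x, y} \<notin> F1" "{x, y} \<notin> F2" "F1 \<inter> F2 = {}"
      using assms by (auto simp: F1_def F2_def)
    show r1: "(x, v) \<in> ?R" if "v \<in> \<Union>F1" for v
      using that all unfolding F1_def by blast
    show r2: "(x, v) \<notin> ?R" if "v \<in> \<Union>F2" for v
      using that unfolding F1_def F2_def by blast
    show "y \<notin> \<Union>F1" "x \<notin> \<Union>F2" "\<Union>F1 \<inter> \<Union>F2 = {}"
      using r1 r2 nxy reach_refl by (blast, metis, blast)
  qed
qed

text \<open>Deleting an edge splits forest and vertex set into two pieces, each with at least one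
  vertex to spare; one of these two pays for the deleted edge.\<close>

lemma acyclic_edges_card_less:
  assumes "finite V" "V \<noteq> {}" "\<forall>e\<in>F. e \<subseteq> V \<and> card e = 2" "acyclic_edges F"
  shows "card F < card V"
  using assms
proof (induction "card F" arbitrary: F V rule: less_induct)
  case less
  have fin: "finite F"
    using less.prems by (meson PowI finite_Pow_iff finite_subset subsetI)
  show ?case
  proof (cases "F = {}")
    case True
    then show ?thesis using less.prems by (simp add: card_gt_0_iff)
  next
    case False
    then obtain e where e: "e \<in> F" by auto
    then obtain x y where xy: "e = {x, y}" "x \<noteq> y" using less.prems by (metis card_2_iff)
    obtain F1 F2 where S: "F = insert {x, y} (F1 \<union> F2)" "{x, y} \<notin> F1" "{x, y} \<notin> F2"
      "F1 \<inter> F2 = {}" "y \<notin> \<Union>F1" "x \<notin> \<Union>F2" "\<Union>F1 \<inter> \<Union>F2 = {}"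
      and r1: "\<And>v. v \<in> \<Union>F1 \<Longrightarrow> (x, v) \<in> reach (F - {{x, y}})"
      and r2: "\<And>v. v \<in> \<Union>F2 \<Longrightarrow> (x, v) \<notin> reach (F - {{x, y}})"
      using acyclic_split [of F x y] less.prems e xy by blast
    define V1 where "V1 = {v \<in> V. (x, v) \<in> reach (F - {{x, y}})}"
    define V2 where "V2 = V - V1"
    have f12: "finite F1" "finite F2" using fin S by auto
    have cF: "card F = Suc (card F1 + card F2)"
      using S f12 by (simp add: card_Un_disjoint)
    have xV: "x \<in> V1" "y \<in> V2"
      using less.prems e xy unfolding V1_def V2_def acyclic_edges_def by auto
    have "card F1 < card V1"
    proof (rule less.hyps)
      show "\<forall>e\<in>F1. e \<subseteq> V1 \<and> card e = 2" using less.prems S(1) r1 V1_def by blast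
      show "acyclic_edges F1" using less.prems S(1) acyclic_edges_subset by blast
    qed (use cF xV less.prems V1_def in auto)
    moreover have "card F2 < card V2"
    proof (rule less.hyps)
      show "\<forall>e\<in>F2. e \<subseteq> V2 \<and> card e = 2" using less.prems S(1) r2 V1_def V2_def by blast
      show "acyclic_edges F2" using less.prems S(1) acyclic_edges_subset by blast
    qed (use cF xV less.prems V2_def in auto)
    moreover have "card V = card V1 + card V2"
    proof -
      have "V1 \<subseteq> V" "finite V1" using less.prems V1_def by auto
      then show ?thesis unfolding V2_def using less.prems
        by (simp add: card_Diff_subset card_mono)
    qed
    ultimately show ?thesis using cF by simp
  qed
qed

section \<open>Paths and cycles as lists of vertices\<close>

lemma reach_imp_path:
  assumes "(x, y) \<in> reach F"
  shows "\<exists>vs. vs \<noteq> [] \<and> distinct vs \<and> hd vs = x \<and> last vs = y \<and> successively (\<lambda>a b. {a, b} \<in> F) vs"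
  using assms unfolding reach_def
proof (induction rule: rtrancl_induct)
  case base
  show ?case by (rule exI [of _ "[x]"]) auto
next
  case (step y z)
  then obtain vs where vs: "vs \<noteq> []" "distinct vs" "hd vs = x" "last vs = y"
    "successively (\<lambda>a b. {a, b} \<in> F) vs" by blast
  show ?case
  proof (cases "z \<in> set vs")
    case False
    then show ?thesis using vs step.hyps
      by (intro exI [of _ "vs @ [z]"]) (auto simp: successively_append_iff)
  next
    case True
    then obtain us ws where "vs = us @ z # ws" by (meson split_list)
    then show ?thesis using vs
      by (intro exI [of _ "us @ [z]"]) (auto simp: successively_append_iff hd_append split: if_splits)
  qed
qed

lemma path_imp_reach:
  assumes "vs \<noteq> []" "successively (\<lambda>a b. {a, b} \<in> F) vs"
  shows "(hd vs, last vs) \<in> reach F"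
  using assms
proof (induction vs rule: induct_list012)
  case (3 x y zs)
  then show ?case by (auto intro: reach_trans [OF reach_edge])
qed auto

lemma path_edges_subset: "e \<in> path_edges vs \<Longrightarrow> e \<subseteq> set vs"
  by (induction vs rule: path_edges.induct) auto

lemma finite_path_edges [simp]: "finite (path_edges vs)"
  by (induction vs rule: path_edges.induct) auto

lemma card_path_edges: "distinct vs \<Longrightarrow> card (path_edges vs) = length vs - 1"
proof (induction vs rule: path_edges.induct)
  case (1 x y zs)
  have "{x, y} \<notin> path_edges (y # zs)"
    using path_edges_subset [of "{x, y}" "y # zs"] 1 by auto
  then show ?case using 1 by simp
qed auto

lemma path_edges_in: "successively (\<lambda>a b. {a, b} \<in> F) vs \<Longrightarrow> path_edges vs \<subseteq> F"
  by (induction vs rule: path_edges.induct) auto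

lemma path_edges_split:
  "e \<in> path_edges vs \<Longrightarrow> \<exists>us a b ws. vs = us @ a # b # ws \<and> e = {a, b}"
proof (induction vs rule: path_edges.induct)
  case (1 x y zs)
  show ?case
  proof (cases "e = {x, y}")
    case True
    then show ?thesis by (intro exI [of _ "[]"]) auto
  next
    case False
    then obtain us a b ws where "y # zs = us @ a # b # ws" "e = {a, b}" using 1 by auto
    then show ?thesis by (intro exI [of _ "x # us"]) auto
  qed
qed auto

text \<open>The rest of the cycle, run through its closing edge, still joins \<open>a\<close> to
  \<open>b\<close>. So all edges of a cycle are non-bridges, as the face count requires of the edges
  that it counts.\<close>

lemma cycle_edge_reach:
  assumes vs: "distinct vs" "successively (\<lambda>a b. {a, b} \<in> F) vs" "vs \<noteq> []"
    and e: "{a, b} \<in> path_edges vs" and xy: "{hd vs, last vs} \<notin> F"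
  shows "(a, b) \<in> reach (insert {hd vs, last vs} F - {{a, b}})"
proof -
  let ?G = "insert {hd vs, last vs} F - {{a, b}}"
  obtain us c d ws where sp: "vs = us @ c # d # ws" and cd: "{a, b} = {c, d}"
    using path_edges_split [OF e] by blast
  have inF: "{a, b} \<in> F" using e path_edges_in vs by blast
  have "successively (\<lambda>a b. {a, b} \<in> ?G) (us @ [c])"
  proof (rule successively_mono [of "\<lambda>a b. {a, b} \<in> F"])
    show "successively (\<lambda>a b. {a, b} \<in> F) (us @ [c])"
      using vs sp by (auto simp: successively_append_iff)
    show "{u, v} \<in> ?G" if "u \<in> set (us @ [c])" "v \<in> set (us @ [c])" "{u, v} \<in> F" for u v
      using that vs sp cd by (auto simp: doubleton_eq_iff)
  qed
  from path_imp_reach [OF _ this] have 1: "(hd vs, c) \<in> reach ?G"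
    using sp by (auto simp: hd_append split: if_splits)
  have "successively (\<lambda>a b. {a, b} \<in> ?G) (d # ws)"
  proof (rule successively_mono [of "\<lambda>a b. {a, b} \<in> F"])
    show "successively (\<lambda>a b. {a, b} \<in> F) (d # ws)"
      using vs sp by (auto simp: successively_append_iff)
    show "{u, v} \<in> ?G" if "u \<in> set (d # ws)" "v \<in> set (d # ws)" "{u, v} \<in> F" for u v
      using that vs sp cd by (auto simp: doubleton_eq_iff)
  qed
  from path_imp_reach [OF _ this] have 2: "(d, last vs) \<in> reach ?G"
    using sp by auto
  have "(hd vs, last vs) \<in> reach ?G"
    by (rule reach_edge) (use xy inF in auto)
  then have "(c, d) \<in> reach ?G" using 1 2 by (meson reach_sym reach_trans)
  then show ?thesis using cd reach_sym by (metis doubleton_eq_iff)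
qed

lemma graph_cycle_of_path:
  assumes "simple_graph V E" "{x, y} \<in> E"
    and vs: "vs \<noteq> []" "distinct vs" "hd vs = x" "last vs = y"
      "successively (\<lambda>a b. {a, b} \<in> E - {{x, y}}) vs"
  shows "graph_cycle V E vs"
proof -
  have "x \<noteq> y" using assms by (auto simp: simple_graph_def)
  have inE: "{vs ! i, vs ! Suc i} \<in> E - {{x, y}}" if "Suc i < length vs" for i
    using vs(5) that by (simp add: successively_conv_nth)
  have h: "vs ! 0 = x" "vs ! (length vs - 1) = y" using vs by (auto simp: hd_conv_nth last_conv_nth)
  have l1: "length vs \<noteq> 0" "length vs \<noteq> 1" "length vs \<noteq> 2"
  proof -
    show "length vs \<noteq> 0" using vs by simp
    show "length vs \<noteq> 1" using h \<open>x \<noteq> y\<close> by auto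
    show "length vs \<noteq> 2" using inE [of 0] h by auto
  qed
  then have l: "3 \<le> length vs" by linarith
  have "{vs ! i, vs ! (Suc i mod length vs)} \<in> E" if "i < length vs" for i
  proof (cases "Suc i < length vs")
    case True
    then show ?thesis using inE by auto
  next
    case False
    then have "Suc i = length vs" using that by simp
    then have "i = length vs - 1" "Suc i mod length vs = 0" by auto
    then show ?thesis using h assms(2) by (simp add: insert_commute)
  qed
  moreover from this have "set vs \<subseteq> V"
    using assms(1) unfolding simple_graph_def in_set_conv_nth subset_iff by blast
  ultimately show ?thesis using l vs unfolding graph_cycle_def by blast
qed

section \<open>Faces of plane drawings\<close>

locale plane_drawing =
  fixes V :: "'a set" and E :: "'a set set" and p :: "'a \<Rightarrow> complex"
    and \<gamma> :: "'a set \<Rightarrow> real \<Rightarrow> complex"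
  assumes graph: "simple_graph V E" and embedding: "plane_embedding V E p \<gamma>"
begin

section \<open>Drawings of edge sets as subsets of the plane\<close>

definition drawing :: "'a set set \<Rightarrow> complex set" where
  "drawing F = (\<Union>e\<in>F. path_image (\<gamma> e))"

lemma drawing_insert [simp]: "drawing (insert e F) = path_image (\<gamma> e) \<union> drawing F"
  and drawing_empty [simp]: "drawing {} = {}"
  and drawing_Un [simp]: "drawing (F \<union> G) = drawing F \<union> drawing G"
  by (auto simp: drawing_def)

lemma finite_edges: "finite E"
  using graph unfolding simple_graph_def by (meson PowI finite_Pow_iff finite_subset subsetI)

lemma arc_edge: "e \<in> E \<Longrightarrow> arc (\<gamma> e)"
  and edge_ends: "e \<in> E \<Longrightarrow> {pathstart (\<gamma> e), pathfinish (\<gamma> e)} = p ` e"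
  and edge_Int_vertices: "e \<in> E \<Longrightarrow> path_image (\<gamma> e) \<inter> p ` V = p ` e"
  and edge_Int_edge: "e \<in> E \<Longrightarrow> e' \<in> E \<Longrightarrow> e \<noteq> e' \<Longrightarrow> path_image (\<gamma> e) \<inter> path_image (\<gamma> e') \<subseteq> p ` (e \<inter> e')"
  using embedding unfolding plane_embedding_def by auto

lemma edge_card: "e \<in> E \<Longrightarrow> card e = 2" and edge_subset: "e \<in> E \<Longrightarrow> e \<subseteq> V"
  using graph unfolding simple_graph_def by auto

lemma edge_neq: "{x, y} \<in> E \<Longrightarrow> x \<noteq> y"
  using edge_card by fastforce

lemma compact_edge: "e \<in> E \<Longrightarrow> compact (path_image (\<gamma> e))"
  using arc_edge compact_arc_image by blast

lemma compact_drawing: "F \<subseteq> E \<Longrightarrow> compact (drawing F)"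
  unfolding drawing_def
  by (rule compact_UN) (use finite_edges finite_subset compact_edge in auto)

lemma open_Compl_drawing: "F \<subseteq> E \<Longrightarrow> open (- drawing F)"
  using compact_drawing compact_imp_closed by blast

lemma edge_interior:
  assumes "e \<in> E"
  shows "path_image (\<gamma> e) - p ` e = path_image (\<gamma> e) - {pathstart (\<gamma> e), pathfinish (\<gamma> e)}"
    "connected (path_image (\<gamma> e) - p ` e)" "path_image (\<gamma> e) - p ` e \<noteq> {}"
proof -
  show *: "path_image (\<gamma> e) - p ` e = path_image (\<gamma> e) - {pathstart (\<gamma> e), pathfinish (\<gamma> e)}"
    using edge_ends [OF assms] by simp
  show "connected (path_image (\<gamma> e) - p ` e)" "path_image (\<gamma> e) - p ` e \<noteq> {}"
    unfolding * using arc_edge [OF assms] arc_imp_simple_path connected_simple_path_endless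
      nonempty_simple_path_endless by blast+
qed

lemma edge_interior_disjoint:
  assumes "e \<in> E" "F \<subseteq> E" "e \<notin> F"
  shows "(path_image (\<gamma> e) - p ` e) \<inter> drawing F = {}"
  using edge_Int_edge [of e] assms unfolding drawing_def by fastforce

lemma oriented_edge:
  assumes "{x, y} \<in> E"
  obtains g where "arc g" "pathstart g = p x" "pathfinish g = p y" "path_image g = path_image (\<gamma> {x, y})"
proof -
  consider "pathstart (\<gamma> {x, y}) = p x" "pathfinish (\<gamma> {x, y}) = p y"
    | "pathstart (\<gamma> {x, y}) = p y" "pathfinish (\<gamma> {x, y}) = p x"
    using edge_ends [OF assms] by (auto simp: doubleton_eq_iff)
  then show thesis
  proof cases
    case 1
    then show ?thesis using that [of "\<gamma> {x, y}"] arc_edge assms by auto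
  next
    case 2
    then show ?thesis using that [of "reversepath (\<gamma> {x, y})"] arc_edge assms
      by (auto simp: arc_reversepath)
  qed
qed

lemma path_arc:
  assumes "distinct vs" "2 \<le> length vs" "successively (\<lambda>a b. {a, b} \<in> E) vs"
  obtains g where "arc g" "pathstart g = p (hd vs)" "pathfinish g = p (last vs)"
    "path_image g = drawing (path_edges vs)"
  using assms
proof (induction vs arbitrary: thesis rule: path_edges.induct)
  case (1 x y zs)
  have xy: "{x, y} \<in> E" using "1.prems" by simp
  obtain g1 where g1: "arc g1" "pathstart g1 = p x" "pathfinish g1 = p y"
    "path_image g1 = path_image (\<gamma> {x, y})" using oriented_edge [OF xy] .
  show ?case
  proof (cases zs)
    case Nil
    then show ?thesis using "1.prems"(1) [of g1] g1 by simp
  next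
    case (Cons z ws)
    obtain g2 where g2: "arc g2" "pathstart g2 = p y" "pathfinish g2 = p (last (y # zs))"
      "path_image g2 = drawing (path_edges (y # zs))"
      using "1.IH" "1.prems" Cons by auto
    have "path_image (\<gamma> {x, y}) \<inter> path_image (\<gamma> e) \<subseteq> {p y}" if "e \<in> path_edges (y # zs)" for e
    proof -
      have "e \<subseteq> set (y # zs)" using path_edges_subset that by metis
      then have "x \<notin> e" using "1.prems" by auto
      moreover have "e \<in> E" using that path_edges_in [of E "y # zs"] "1.prems" by auto
      moreover have "e \<noteq> {x, y}" using \<open>x \<notin> e\<close> by auto
      ultimately have "path_image (\<gamma> {x, y}) \<inter> path_image (\<gamma> e) \<subseteq> p ` ({x, y} \<inter> e)"
        using edge_Int_edge xy by metis
      then show ?thesis using \<open>x \<notin> e\<close> by auto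
    qed
    then have "path_image g1 \<inter> path_image g2 \<subseteq> {pathstart g2}"
      using g1 g2 unfolding drawing_def by auto
    then have "arc (g1 +++ g2)" using g1 g2 arc_join by metis
    moreover have "path_image (g1 +++ g2) = drawing (path_edges (x # y # zs))"
      using g1 g2 by (simp add: path_image_join)
    ultimately show ?thesis using "1.prems"(1) [of "g1 +++ g2"] g1 g2 by simp
  qed
qed auto

text \<open>The closed curve is delivered as the arc of one edge plus a connected remainder
  \<open>Q\<close> in the other edges: the Jordan curve theorem is applied to the whole curve,
  Janiszewski's theorem to \<open>Q\<close>.\<close>

lemma cycle_curve:
  assumes e: "{x, y} \<in> E" and r: "(x, y) \<in> reach (F - {{x, y}})" and F: "F \<subseteq> E"
  obtains c Q where "simple_path c" "pathfinish c = pathstart c"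
    "path_image c = path_image (\<gamma> {x, y}) \<union> Q" "connected Q" "Q \<subseteq> drawing (F - {{x, y}})"
    "p ` {x, y} \<subseteq> Q"
proof -
  obtain vs where vs: "vs \<noteq> []" "distinct vs" "hd vs = x" "last vs = y"
    and succ: "successively (\<lambda>a b. {a, b} \<in> F - {{x, y}}) vs"
    using reach_imp_path [OF r] by blast
  have len: "2 \<le> length vs"
  proof (rule ccontr)
    assume "\<not> 2 \<le> length vs"
    then have "x = y" using vs by (cases vs; cases "tl vs") auto
    then show False using edge_neq e by blast
  qed
  have "successively (\<lambda>a b. {a, b} \<in> E) vs"
    using succ by (rule successively_mono) (use F in auto)
  from path_arc [OF vs(2) len this] obtain g where g: "arc g" "pathstart g = p x" "pathfinish g = p y"
    "path_image g = drawing (path_edges vs)" using vs by metis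
  obtain h where h: "arc h" "pathstart h = p y" "pathfinish h = p x"
    "path_image h = path_image (\<gamma> {x, y})" using oriented_edge [of y x] e by (metis insert_commute)
  have sub: "path_edges vs \<subseteq> F - {{x, y}}" by (rule path_edges_in [OF succ])
  then have "path_image (\<gamma> {x, y}) \<inter> path_image (\<gamma> e') \<subseteq> {p x, p y}" if "e' \<in> path_edges vs" for e'
    using edge_Int_edge [OF e, of e'] that F by blast
  then have "path_image g \<inter> path_image h \<subseteq> {pathstart g, pathstart h}"
    using g h unfolding drawing_def by auto
  then have "simple_path (g +++ h)" using g h simple_path_join_loop by metis
  then show thesis
  proof (rule that [of "g +++ h" "path_image g"])
    show "path_image g \<subseteq> drawing (F - {{x, y}})" using g sub unfolding drawing_def by blast
    show "p ` {x, y} \<subseteq> path_image g" using g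
      by (metis empty_subsetI image_insert image_empty insert_subset pathfinish_in_path_image pathstart_in_path_image)
    show "connected (path_image g)" using g(1) by (rule connected_arc_image)
  qed (use g h in \<open>auto simp: path_image_join\<close>)
qed

text \<open>Split at an edge: its arc meets the drawing of \<open>F1\<close> at most in
  \<open>p x\<close>, and both together meet the drawing of \<open>F2\<close> at most in
  \<open>p y\<close>. Sets with at most one point are connected, so Janiszewski's theorem applies
  twice.\<close>

lemma connected_Compl_acyclic_drawing:
  assumes "F \<subseteq> E" "acyclic_edges F"
  shows "connected (- drawing F)"
  using assms
proof (induction "card F" arbitrary: F rule: less_induct)
  case less
  have fin: "finite F" using less.prems finite_edges finite_subset by blast
  show ?case
  proof (cases "F = {}")
    case False
    then obtain e where e: "e \<in> F" by auto
    then obtain x y where xy: "e = {x, y}" "x \<noteq> y" using less.prems edge_card by (metis card_2_iff subsetD)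
    obtain F1 F2 where S: "F = insert {x, y} (F1 \<union> F2)" "{x, y} \<notin> F1" "{x, y} \<notin> F2"
      "F1 \<inter> F2 = {}" "y \<notin> \<Union>F1" "x \<notin> \<Union>F2" "\<Union>F1 \<inter> \<Union>F2 = {}"
      using acyclic_split [of F x y] less.prems e xy edge_card by (metis subsetD)
    have f12: "finite F1" "finite F2" using fin S by auto
    have cF: "card F = Suc (card F1 + card F2)"
      using S f12 by (simp add: card_Un_disjoint)
    have sub: "F1 \<subseteq> E" "F2 \<subseteq> E" "{x, y} \<in> E" using less.prems S(1) by auto
    have c1: "connected (- drawing F1)" "connected (- drawing F2)"
      using less.hyps [of F1] less.hyps [of F2] cF sub less.prems S(1) acyclic_edges_subset by auto
    have i1: "path_image (\<gamma> {x, y}) \<inter> drawing F1 \<subseteq> {p x}"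
      using edge_Int_edge [of "{x, y}"] sub S(2,5) unfolding drawing_def by fastforce
    have "path_image (\<gamma> {x, y}) \<inter> drawing F2 \<subseteq> {p y}"
      using edge_Int_edge [of "{x, y}"] sub S(3,6) unfolding drawing_def by fastforce
    moreover have "drawing F1 \<inter> drawing F2 = {}"
    proof -
      have "path_image (\<gamma> e1) \<inter> path_image (\<gamma> e2) = {}" if "e1 \<in> F1" "e2 \<in> F2" for e1 e2
      proof -
        have "e1 \<inter> e2 = {}" using that S(7) by blast
        moreover have "e1 \<noteq> e2" using that S(4) by blast
        ultimately show ?thesis using edge_Int_edge [of e1 e2] sub that by auto
      qed
      then show ?thesis unfolding drawing_def by blast
    qed
    ultimately have i2: "(drawing F1 \<union> path_image (\<gamma> {x, y})) \<inter> drawing F2 \<subseteq> {p y}" by blast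
    have sing: "connected A" if "A \<subseteq> {z}" for A and z :: complex
      using that by (auto simp: subset_singleton_iff)
    have cl: "closed (path_image (\<gamma> {x, y}))"
      using sub compact_edge compact_imp_closed by blast
    have "connected (- (drawing F1 \<union> path_image (\<gamma> {x, y})))"
    proof (rule Janiszewski_connected)
      show "connected (- path_image (\<gamma> {x, y}))"
        using connected_arc_complement [OF arc_edge [OF sub(3)]] by simp
      show "connected (drawing F1 \<inter> path_image (\<gamma> {x, y}))"
        using sing i1 by (metis Int_commute)
    qed (use c1 sub compact_drawing cl in auto)
    then have "connected (- ((drawing F1 \<union> path_image (\<gamma> {x, y})) \<union> drawing F2))"
    proof (rule Janiszewski_connected [rotated 3])
      show "connected ((drawing F1 \<union> path_image (\<gamma> {x, y})) \<inter> drawing F2)"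
        using sing i2 by metis
    qed (use c1 sub compact_drawing compact_edge compact_imp_closed [OF compact_drawing] in \<open>auto intro: compact_Un\<close>)
    then show ?thesis using S(1) by (simp add: Un_ac)
  qed (simp add: convex_connected)
qed

section \<open>Lower bound on the number of faces\<close>

lemma separated_mono:
  assumes "\<not> connected_component (- S) a b" "S \<subseteq> T"
  shows "\<not> connected_component (- T) a b"
  using assms connected_component_of_subset by (metis Compl_subset_Compl_iff)

lemma separated_by_curve:
  fixes c :: "real \<Rightarrow> complex"
  assumes "simple_path c" "pathfinish c = pathstart c" "a \<in> inside (path_image c)" "b \<in> outside (path_image c)"
  shows "\<not> connected_component (- path_image c) a b"
  using assms by (metis IntI empty_iff inside_Int_outside inside_same_component)

lemma separated_points_insert:
  assumes e: "{x, y} \<in> E" "{x, y} \<notin> F" and F: "F \<subseteq> E" and r: "(x, y) \<in> reach F"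
    and A: "finite A" "A \<inter> drawing F = {}"
      "\<And>a b. a \<in> A \<Longrightarrow> b \<in> A \<Longrightarrow> a \<noteq> b \<Longrightarrow> \<not> connected_component (- drawing F) a b"
  shows "\<exists>A'. finite A' \<and> card A' = Suc (card A) \<and> A' \<inter> drawing (insert {x, y} F) = {} \<and>
    (\<forall>a\<in>A'. \<forall>b\<in>A'. a \<noteq> b \<longrightarrow> \<not> connected_component (- drawing (insert {x, y} F)) a b)"
proof -
  have "(x, y) \<in> reach (insert {x, y} F - {{x, y}})" using r e by simp
  moreover have "insert {x, y} F \<subseteq> E" using e F by simp
  ultimately obtain c Q where c: "simple_path c" "pathfinish c = pathstart c"
    "path_image c = path_image (\<gamma> {x, y}) \<union> Q" and Q': "Q \<subseteq> drawing (insert {x, y} F - {{x, y}})"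
    and ends': "p ` {x, y} \<subseteq> Q"
    using cycle_curve [OF e(1)] by metis
  then have Q: "Q \<subseteq> drawing F" and ends: "p ` {x, y} \<subseteq> drawing F" using e(2) by auto
  let ?I = "path_image (\<gamma> {x, y}) - p ` {x, y}"
  obtain m where m: "m \<in> ?I" using edge_interior(3) [OF e(1)] by blast
  have disj: "?I \<inter> drawing F = {}" using edge_interior_disjoint e F by blast
  \<comment> \<open>\<open>D\<close> is the face of the old drawing that contains the interior of
    the new edge. It is the only face that gets split, so the points of \<open>A\<close> outside it
    are kept.\<close>
  define D where "D = connected_component_set (- drawing F) m"
  have mD: "m \<in> D" using m disj unfolding D_def by auto
  have openD: "open D" unfolding D_def using F open_Compl_drawing by (simp add: open_connected_component)
  have ID: "?I \<subseteq> D"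
    unfolding D_def using m disj edge_interior(2) [OF e(1)] by (intro connected_component_maximal) auto
  have "frontier (inside (path_image c)) = path_image c" "frontier (outside (path_image c)) = path_image c"
    using Jordan_inside_outside [OF c(1,2)] by auto
  \<comment> \<open>By the Jordan curve theorem both sides of the curve accumulate at the inner
    point \<open>m\<close>, so each of them meets the open set \<open>D\<close>.\<close>
  then have "m \<in> closure (inside (path_image c))" "m \<in> closure (outside (path_image c))"
    using m c(3) by (auto simp: frontier_def)
  then obtain d1 d2 where d: "d1 \<in> D" "d1 \<in> inside (path_image c)" "d2 \<in> D" "d2 \<in> outside (path_image c)"
    using mD openD by (metis disjoint_iff open_Int_closure_eq_empty)
  have csub: "path_image c \<subseteq> drawing (insert {x, y} F)" using c Q by auto
  have sep: "\<not> connected_component (- drawing (insert {x, y} F)) d1 d2"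
    using separated_mono separated_by_curve c d csub by metis
  have Dsub: "D \<subseteq> - drawing F" unfolding D_def by (rule connected_component_subset)
  have new: "d1 \<notin> drawing (insert {x, y} F)" "d2 \<notin> drawing (insert {x, y} F)"
  proof -
    have "d1 \<notin> path_image c" "d2 \<notin> path_image c"
      using d inside_no_overlap outside_no_overlap by fastforce+
    then show "d1 \<notin> drawing (insert {x, y} F)" "d2 \<notin> drawing (insert {x, y} F)"
      using d Dsub c(3) by auto
  qed
  define A0 where "A0 = A - D"
  have A0: "A0 \<inter> drawing (insert {x, y} F) = {}"
    using A(2) ID ends unfolding A0_def by auto
  have sepD: "\<not> connected_component (- drawing F) a d" if "a \<in> A0" "d \<in> D" for a d
    using that unfolding A0_def D_def
    by (metis Diff_iff connected_component_sym connected_component_trans mem_Collect_eq)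
  have mono: "drawing F \<subseteq> drawing (insert {x, y} F)" by auto
  have le: "card A \<le> Suc (card A0)"
  proof -
    have "\<exists>a. A \<inter> D \<subseteq> {a}"
    proof (cases "A \<inter> D = {}")
      case False
      then obtain a where a: "a \<in> A" "a \<in> D" by auto
      have "b = a" if "b \<in> A" "b \<in> D" for b
        using A(3) [OF that(1) a(1)] a that unfolding D_def
        by (metis connected_component_sym connected_component_trans mem_Collect_eq)
      then show ?thesis by blast
    qed auto
    then obtain a where "A \<inter> D \<subseteq> {a}" by blast
    then have "card (A \<inter> D) \<le> 1" using card_mono [of "{a}" "A \<inter> D"] by simp
    moreover have "card A = card A0 + card (A \<inter> D)"
      unfolding A0_def using A(1) by (metis add.commute card_Int_Diff)
    ultimately show ?thesis by simp
  qed
  have neq: "d1 \<noteq> d2" using d by (metis IntI empty_iff inside_Int_outside)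
  have "d1 \<notin> A0" "d2 \<notin> A0" using d A0_def by auto
  then have big: "finite (insert d1 (insert d2 A0))" "card (insert d1 (insert d2 A0)) = Suc (Suc (card A0))"
    using neq A(1) by (auto simp: A0_def)
  have pairwise: "\<not> connected_component (- drawing (insert {x, y} F)) a b"
    if "a \<in> insert d1 (insert d2 A0)" "b \<in> insert d1 (insert d2 A0)" "a \<noteq> b" for a b
  proof -
    have "\<not> connected_component (- drawing (insert {x, y} F)) a b" if "a \<in> A0" "b \<in> A0" "a \<noteq> b" for a b
      using A(3) [of a b] that separated_mono [OF _ mono] A0_def by auto
    moreover have "\<not> connected_component (- drawing (insert {x, y} F)) a b" if "a \<in> A0" "b \<in> D" for a b
      using sepD [OF that] separated_mono [OF _ mono] by blast
    ultimately show ?thesis using that sep d connected_component_sym by (metis insertE)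
  qed
  \<comment> \<open>If \<open>A\<close> has no point in \<open>D\<close> there is now one point too
    many, hence the passage to a subset of the exact size.\<close>
  obtain A' where A': "A' \<subseteq> insert d1 (insert d2 A0)" "card A' = Suc (card A)"
    using obtain_subset_with_card_n [of "Suc (card A)" "insert d1 (insert d2 A0)"] big le by auto
  show ?thesis
  proof (intro exI [of _ A'] conjI ballI impI)
    show "finite A'" using A' big finite_subset by blast
    show "A' \<inter> drawing (insert {x, y} F) = {}" using A' new A0 by blast
    show "\<not> connected_component (- drawing (insert {x, y} F)) a b"
      if "a \<in> A'" "b \<in> A'" "a \<noteq> b" for a b
      using that A'(1) by (intro pairwise) blast+
  qed (rule A'(2))
qed

text \<open>The face-producing inequality of Euler's formula: one point for the spanning forest, and
  one more for each further edge, since its ends are already joined.\<close>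

lemma separated_points:
  assumes "F0 \<subseteq> E" and r: "\<And>x y. {x, y} \<in> E \<Longrightarrow> (x, y) \<in> reach F0"
  obtains A where "finite A" "card A = Suc (card E - card F0)" "A \<inter> drawing E = {}"
    "\<And>a b. a \<in> A \<Longrightarrow> b \<in> A \<Longrightarrow> a \<noteq> b \<Longrightarrow> \<not> connected_component (- drawing E) a b"
proof -
  have "\<exists>A. finite A \<and> card A = Suc (card B) \<and> A \<inter> drawing (F0 \<union> B) = {} \<and>
     (\<forall>a\<in>A. \<forall>b\<in>A. a \<noteq> b \<longrightarrow> \<not> connected_component (- drawing (F0 \<union> B)) a b)"
    if "B \<subseteq> E - F0" for B
  proof -
    have "finite B" using that finite_edges finite_subset by blast
    then show ?thesis using that
    proof (induction B rule: finite_induct)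
      case empty
      have "bounded (drawing F0)" using compact_drawing [OF assms(1)] compact_imp_bounded by blast
      then have "- drawing F0 \<noteq> {}" using not_bounded_UNIV by (metis Compl_empty_eq double_compl)
      then obtain a where "a \<notin> drawing F0" by auto
      then show ?case by (intro exI [of _ "{a}"]) auto
    next
      case (insert e B)
      then obtain A where A: "finite A" "card A = Suc (card B)" "A \<inter> drawing (F0 \<union> B) = {}"
        "\<And>a b. a \<in> A \<Longrightarrow> b \<in> A \<Longrightarrow> a \<noteq> b \<Longrightarrow> \<not> connected_component (- drawing (F0 \<union> B)) a b"
        by auto
      obtain x y where xy: "e = {x, y}" using insert.prems edge_card by (metis DiffD1 card_2_iff insertI1 subsetD)
      have "(x, y) \<in> reach (F0 \<union> B)"
        using r [of x y] xy insert.prems reach_mono [of F0 "F0 \<union> B"] by auto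
      then have "\<exists>A'. finite A' \<and> card A' = Suc (card A) \<and> A' \<inter> drawing (insert {x, y} (F0 \<union> B)) = {} \<and>
        (\<forall>a\<in>A'. \<forall>b\<in>A'. a \<noteq> b \<longrightarrow> \<not> connected_component (- drawing (insert {x, y} (F0 \<union> B))) a b)"
        by (intro separated_points_insert A) (use insert assms xy in auto)
      then show ?case using A insert xy by simp
    qed
  qed
  from this [of "E - F0"] obtain A where "finite A" "card A = Suc (card (E - F0))" "A \<inter> drawing E = {}"
    "\<And>a b. a \<in> A \<Longrightarrow> b \<in> A \<Longrightarrow> a \<noteq> b \<Longrightarrow> \<not> connected_component (- drawing E) a b"
    using assms by (metis Diff_partition order_refl)
  then show thesis using that assms finite_edges by (metis card_Diff_subset finite_subset)
qed

text \<open>Ends of edges are excluded because the closure of a face may reach an edge just at a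
  vertex, without the edge bounding the face.\<close>

definition touches :: "complex set \<Rightarrow> 'a set \<Rightarrow> bool" where
  "touches C e \<longleftrightarrow> closure C \<inter> (path_image (\<gamma> e) - p ` e) \<noteq> {}"

text \<open>If the touched edges were acyclic, the complement of their drawing, less the vertices,
  would be connected and would miss the frontier of the face. It would then lie inside the face,
  although it contains inner points of an untouched edge.\<close>

lemma face_boundary_not_acyclic:
  assumes "\<not> acyclic_edges E" "a \<notin> drawing E"
  shows "\<not> acyclic_edges {e \<in> E. touches (connected_component_set (- drawing E) a) e}"
proof
  define C where "C = connected_component_set (- drawing E) a"
  define B where "B = {e \<in> E. touches C e}"
  assume "acyclic_edges {e \<in> E. touches (connected_component_set (- drawing E) a) e}"
  then have "acyclic_edges B" "B \<subseteq> E" by (auto simp: B_def C_def)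
  then have "B \<noteq> E" using assms by auto
  then obtain e where e: "e \<in> E" "e \<notin> B" using \<open>B \<subseteq> E\<close> by auto
  \<comment> \<open>Vertices are removed because the frontier of \<open>C\<close> may contain an end
    of an untouched edge; removing finitely many points keeps an open connected set
    connected.\<close>
  define S where "S = - drawing B - p ` V"
  have finV: "finite V" using graph by (simp add: simple_graph_def)
  have conS: "connected S"
    unfolding S_def using connected_Compl_acyclic_drawing \<open>acyclic_edges B\<close> \<open>B \<subseteq> E\<close> open_Compl_drawing finV
    by (intro connected_open_delete_finite) auto
  have openC: "open C" unfolding C_def using open_Compl_drawing by (simp add: open_connected_component)
  have aC: "a \<in> C" using assms by (auto simp: C_def)
  have Csub: "C \<subseteq> - drawing E" unfolding C_def by (rule connected_component_subset)
  have "frontier C \<subseteq> drawing E"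
  proof -
    have "frontier C \<subseteq> frontier (- drawing E)"
      unfolding C_def by (rule frontier_of_connected_component_subset)
    also have "\<dots> \<subseteq> drawing E"
      using compact_drawing [of E] compact_imp_closed frontier_subset_closed by (auto simp: frontier_complement)
    finally show ?thesis .
  qed
  moreover have "z \<in> drawing B \<union> p ` V" if "z \<in> closure C" "z \<in> path_image (\<gamma> e')" "e' \<in> E" for z e'
  proof (cases "z \<in> p ` e'")
    case True
    then show ?thesis using edge_subset that by blast
  next
    case False
    then have "touches C e'" unfolding touches_def using that by blast
    then show ?thesis using that unfolding B_def drawing_def by auto
  qed
  ultimately have fr: "frontier C \<subseteq> drawing B \<union> p ` V"
    unfolding drawing_def frontier_def by blast
  have "S \<subseteq> C"
  proof (rule ccontr)
    assume "\<not> S \<subseteq> C"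
    moreover have "S \<inter> C \<noteq> {}"
    proof -
      have "infinite C" using openC aC finite_imp_not_open by blast
      then obtain z where "z \<in> C" "z \<notin> p ` V" using finV by (meson finite_imageI finite_subset subsetI)
      moreover have "z \<notin> drawing B" using \<open>z \<in> C\<close> Csub \<open>B \<subseteq> E\<close> unfolding drawing_def by blast
      ultimately show ?thesis unfolding S_def by blast
    qed
    ultimately have "S \<inter> frontier C \<noteq> {}" using connected_Int_frontier [OF conS] by blast
    then show False using fr unfolding S_def by blast
  qed
  moreover obtain m where m: "m \<in> path_image (\<gamma> e) - p ` e" using edge_interior(3) [OF e(1)] by blast
  moreover have "m \<in> S"
    unfolding S_def using m edge_Int_vertices [OF e(1)] edge_interior_disjoint [OF e(1) \<open>B \<subseteq> E\<close> e(2)] by blast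
  ultimately have "m \<in> - drawing E" using Csub by blast
  then show False using m e unfolding drawing_def by blast
qed

text \<open>The faces touching the edge all lie in one face \<open>D\<close> of the drawing without
  it. A cycle through the edge meets the other edges in the connected set \<open>Q\<close>, so by
  Janiszewski's theorem two such points on the same side of the cycle lie in the same face. There
  are two sides.\<close>

lemma card_faces_touching_le:
  assumes e: "{x, y} \<in> E" and r: "(x, y) \<in> reach (E - {{x, y}})"
    and A: "finite A" "A \<inter> drawing E = {}"
      "\<And>a b. a \<in> A \<Longrightarrow> b \<in> A \<Longrightarrow> a \<noteq> b \<Longrightarrow> \<not> connected_component (- drawing E) a b"
  shows "card {a \<in> A. touches (connected_component_set (- drawing E) a) {x, y}} \<le> 2"
proof -
  let ?E' = "E - {{x, y}}" and ?I = "path_image (\<gamma> {x, y}) - p ` {x, y}"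
  let ?T = "{a \<in> A. touches (connected_component_set (- drawing E) a) {x, y}}"
  obtain c Q where c: "simple_path c" "pathfinish c = pathstart c"
    "path_image c = path_image (\<gamma> {x, y}) \<union> Q" and Q: "connected Q" "Q \<subseteq> drawing ?E'" "p ` {x, y} \<subseteq> Q"
    using cycle_curve [OF e r] by auto
  obtain m where m: "m \<in> ?I" using edge_interior(3) [OF e] by blast
  have disj: "?I \<inter> drawing ?E' = {}" using edge_interior_disjoint e by blast
  have E: "drawing E = drawing ?E' \<union> path_image c"
  proof -
    have "drawing E = path_image (\<gamma> {x, y}) \<union> drawing ?E'"
      using e by (metis drawing_insert insert_Diff)
    then show ?thesis using c(3) Q(2) by blast
  qed
  define D where "D = connected_component_set (- drawing ?E') m"
  have ID: "?I \<subseteq> D"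
    unfolding D_def using m disj edge_interior(2) [OF e] by (intro connected_component_maximal) auto
  have openD: "open D" unfolding D_def using open_Compl_drawing by (simp add: open_connected_component)
  have inD: "a \<in> D" if a: "a \<in> ?T" for a
  proof -
    let ?C = "connected_component_set (- drawing E) a"
    have "closure ?C \<inter> D \<noteq> {}" using a ID unfolding touches_def by blast
    then obtain z where z: "z \<in> ?C" "z \<in> D" using openD by (metis disjoint_iff Int_commute open_Int_closure_eq_empty)
    have "connected_component (- drawing ?E') a z"
      using z E by (metis Compl_subset_Compl_iff Un_upper1 connected_component_of_subset mem_Collect_eq)
    then show ?thesis using z unfolding D_def
      by (metis connected_component_sym connected_component_trans mem_Collect_eq)
  qed
  have same: "a = b" if ab: "a \<in> ?T" "b \<in> ?T" "connected_component (- path_image c) a b" for a b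
  proof (rule ccontr)
    assume "a \<noteq> b"
    have "connected_component (- (drawing ?E' \<union> path_image c)) a b"
    proof (rule Janiszewski)
      show "compact (drawing ?E')" "closed (path_image c)"
        using compact_drawing closed_simple_path_image [OF c(1)] by auto
      have "drawing ?E' \<inter> path_image c = Q" using c(3) Q disj by blast
      then show "connected (drawing ?E' \<inter> path_image c)" using Q by simp
      have "connected_component (- drawing ?E') m a" "connected_component (- drawing ?E') m b"
        using inD [OF ab(1)] inD [OF ab(2)] unfolding D_def by (simp_all only: mem_Collect_eq)
      then show "connected_component (- drawing ?E') a b"
        using connected_component_sym connected_component_trans by metis
    qed (use ab in auto)
    then show False using A(3) [of a b] ab \<open>a \<noteq> b\<close> E by auto
  qed
  have J: "connected (inside (path_image c))" "connected (outside (path_image c))"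
    "inside (path_image c) \<union> outside (path_image c) = - path_image c"
    using Jordan_inside_outside [OF c(1,2)] by auto
  have 1: "card {a \<in> ?T. a \<in> U} \<le> 1" if U: "connected U" "U \<subseteq> - path_image c" for U
  proof -
    have "a = b" if "a \<in> {a \<in> ?T. a \<in> U}" "b \<in> {a \<in> ?T. a \<in> U}" for a b
    proof (rule same)
      show "connected_component (- path_image c) a b"
        unfolding connected_component_def using that U by blast
    qed (use that in auto)
    then show ?thesis using A(1) by (intro card_le_Suc0_iff_eq [THEN iffD2, folded One_nat_def]) auto
  qed
  have "?T \<subseteq> {a \<in> ?T. a \<in> inside (path_image c)} \<union> {a \<in> ?T. a \<in> outside (path_image c)}"
    using A(2) E J(3) by blast
  then have "card ?T \<le> card ({a \<in> ?T. a \<in> inside (path_image c)} \<union> {a \<in> ?T. a \<in> outside (path_image c)})"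
    using A(1) by (intro card_mono) auto
  also have "\<dots> \<le> card {a \<in> ?T. a \<in> inside (path_image c)} + card {a \<in> ?T. a \<in> outside (path_image c)}"
    by (rule card_Un_le)
  also have "\<dots> \<le> 1 + 1"
    by (intro add_mono 1 J(1,2)) (use J(3) in blast)+
  finally show ?thesis by simp
qed

text \<open>Pairs of a face and a touching non-bridge are counted twice over: at least
  \<open>g\<close> per face, at most 2 per edge. With at least |E| - |V| + 2 faces this gives g(|E|
  - |V| + 2) \<le> 2|E|. Forests are treated apart, as their only face has no cycle on its
  boundary.\<close>

lemma edges_le_girth_bound:
  fixes g :: real
  assumes V: "V \<noteq> {}" and g: "2 < g" and girth: "\<And>vs. graph_cycle V E vs \<Longrightarrow> g \<le> length vs"
  shows "(g - 2) * card E < g * card V"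
proof -
  have finV: "finite V" using graph by (simp add: simple_graph_def)
  obtain F0 where F0: "F0 \<subseteq> E" "acyclic_edges F0" and r: "\<And>x y. {x, y} \<in> E \<Longrightarrow> (x, y) \<in> reach F0"
    using maximal_acyclic [OF finite_edges] by blast
  have less: "card F0 < card V"
    using acyclic_edges_card_less [OF finV V _ F0(2)] F0(1) edge_card edge_subset by blast
  show ?thesis
  proof (cases "acyclic_edges E")
    case True
    then have "card E < card V"
      using acyclic_edges_card_less [OF finV V] edge_card edge_subset by blast
    then have "(g - 2) * card E \<le> (g - 2) * card V" using g by simp
    also have "\<dots> < g * card V" using V finV by (simp add: card_gt_0_iff)
    finally show ?thesis .
  next
    case False
    obtain A where A: "finite A" "card A = Suc (card E - card F0)" "A \<inter> drawing E = {}"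
      "\<And>a b. a \<in> A \<Longrightarrow> b \<in> A \<Longrightarrow> a \<noteq> b \<Longrightarrow> \<not> connected_component (- drawing E) a b"
      using separated_points [OF F0(1) r] by blast
    \<comment> \<open>The bound of two faces per edge relies on a cycle through the edge, so only
      non-bridges are counted.\<close>
    define R where "R = {e \<in> E. \<exists>x y. e = {x, y} \<and> (x, y) \<in> reach (E - {{x, y}})}"
    define T where "T = (\<lambda>a e. touches (connected_component_set (- drawing E) a) e)"
    have finR: "finite R" unfolding R_def using finite_edges by simp
    have lower: "g \<le> card {e \<in> R. T a e}" if "a \<in> A" for a
    proof -
      have "\<not> acyclic_edges {e \<in> E. T a e}"
        unfolding T_def using face_boundary_not_acyclic [OF False] A(3) that by blast
      then obtain x y where xy: "{x, y} \<in> E" "T a {x, y}" "(x, y) \<in> reach ({e \<in> E. T a e} - {{x, y}})"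
        unfolding acyclic_edges_def by blast
      from reach_imp_path [OF xy(3)] obtain vs where vs: "vs \<noteq> []" "distinct vs" "hd vs = x" "last vs = y"
        "successively (\<lambda>u v. {u, v} \<in> {e \<in> E. T a e} - {{x, y}}) vs" by blast
      have sE: "successively (\<lambda>u v. {u, v} \<in> E - {{x, y}}) vs"
        using vs(5) by (rule successively_mono) auto
      have "g \<le> length vs"
        using girth graph_cycle_of_path [OF graph xy(1) vs(1-4) sE] by blast
      have sub: "path_edges vs \<subseteq> {e \<in> E. T a e} - {{x, y}}" by (rule path_edges_in [OF vs(5)])
      have "path_edges vs \<subseteq> R"
      proof
        fix e assume e: "e \<in> path_edges vs"
        then obtain u v where uv: "e = {u, v}" using path_edges_split by blast
        have "(u, v) \<in> reach (insert {x, y} (E - {{x, y}}) - {{u, v}})"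
          using cycle_edge_reach [OF vs(2) sE vs(1)] e uv vs by auto
        then show "e \<in> R" unfolding R_def using uv e sub xy(1) by (auto simp: insert_absorb)
      qed
      moreover have "{x, y} \<in> R"
        unfolding R_def using xy reach_mono [of "{e \<in> E. T a e} - {{x, y}}" "E - {{x, y}}"] by blast
      ultimately have "insert {x, y} (path_edges vs) \<subseteq> {e \<in> R. T a e}" using sub xy by auto
      then have "card (insert {x, y} (path_edges vs)) \<le> card {e \<in> R. T a e}"
        using finR by (intro card_mono) auto
      moreover have "card (insert {x, y} (path_edges vs)) = length vs"
        using sub vs card_path_edges [OF vs(2)] by (auto simp: card_insert_if)
      ultimately show ?thesis using \<open>g \<le> length vs\<close> by linarith
    qed
    have upper: "card {a \<in> A. T a e} \<le> 2" if "e \<in> R" for e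
      using that card_faces_touching_le [OF _ _ A(1,3,4)] unfolding R_def T_def by blast
    have "g * card A \<le> (\<Sum>a\<in>A. real (card {e \<in> R. T a e}))"
      using sum_mono [of A "\<lambda>_. g"] lower by (simp add: mult.commute)
    also have "\<dots> = real (\<Sum>a\<in>A. card {e \<in> R. T a e})" by simp
    also have "(\<Sum>a\<in>A. card {e \<in> R. T a e}) = (\<Sum>e\<in>R. card {a \<in> A. T a e})"
      by (rule sum_multicount_gen) (use A(1) finR in auto)
    also have "\<dots> \<le> (\<Sum>e\<in>R. 2)" by (rule sum_mono) (use upper in auto)
    also have "\<dots> \<le> 2 * card E"
      using card_mono [OF finite_edges, of R] unfolding R_def by auto
    finally have main: "g * card A \<le> 2 * card E" by simp
    have "real (card A) = 1 + (real (card E) - card F0)"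
      using A(2) card_mono [OF finite_edges F0(1)] by simp
    then have "real (card A) \<ge> real (card E) - card V + 2" using less by linarith
    then have "g * (real (card E) - card V + 2) \<le> g * card A" using g by simp
    then show ?thesis using main g by (simp add: algebra_simps)
  qed
qed

end

section \<open>Discharging\<close>

definition nbhd :: "'a set set \<Rightarrow> 'a \<Rightarrow> 'a set" where
  "nbhd E v = {u. {u, v} \<in> E}"

text \<open>The number of paths of length two from \<open>v\<close>, that is, its conflicts counted
  with multiplicity. Lightness is tested with this upper bound because it is a sum over the
  neighbors and depends on their degrees only.\<close>

definition weight :: "'a set set \<Rightarrow> 'a \<Rightarrow> nat" where
  "weight E v = (\<Sum>u\<in>nbhd E v. card (nbhd E u) - 1)"

lemma nbhd_sym: "u \<in> nbhd E v \<longleftrightarrow> v \<in> nbhd E u"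
  by (simp add: nbhd_def insert_commute)

lemma simple_graph_finite_edges: "simple_graph V E \<Longrightarrow> finite E"
  unfolding simple_graph_def by (meson PowI finite_Pow_iff finite_subset subsetI)

lemma nbhd_subset: "simple_graph V E \<Longrightarrow> nbhd E v \<subseteq> V"
  by (auto simp: simple_graph_def nbhd_def)

lemma finite_nbhd: "simple_graph V E \<Longrightarrow> finite (nbhd E v)"
  using nbhd_subset finite_subset simple_graph_def by metis

lemma vertex_degree_eq:
  assumes "simple_graph V E"
  shows "vertex_degree E v = card (nbhd E v)"
proof -
  have "bij_betw (\<lambda>u. {u, v}) (nbhd E v) {e \<in> E. v \<in> e}"
  proof (rule bij_betw_imageI)
    show "inj_on (\<lambda>u. {u, v}) (nbhd E v)"
      by (auto simp: inj_on_def doubleton_eq_iff)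
    show "(\<lambda>u. {u, v}) ` nbhd E v = {e \<in> E. v \<in> e}"
    proof (intro equalityI subsetI)
      fix e assume e: "e \<in> {e \<in> E. v \<in> e}"
      then have "card e = 2" using assms by (auto simp: simple_graph_def)
      then obtain u where "e = {u, v}" using e by (auto simp: card_2_iff)
      then show "e \<in> (\<lambda>u. {u, v}) ` nbhd E v" using e by (auto simp: nbhd_def)
    qed (auto simp: nbhd_def)
  qed
  then show ?thesis unfolding vertex_degree_def by (metis bij_betw_same_card)
qed

lemma sum_card_nbhd:
  assumes "simple_graph V E"
  shows "(\<Sum>v\<in>V. card (nbhd E v)) = 2 * card E"
proof -
  have fin: "finite V" "finite E" using assms simple_graph_finite_edges by (auto simp: simple_graph_def)
  have "(\<Sum>v\<in>V. card (nbhd E v)) = (\<Sum>v\<in>V. card {e \<in> E. v \<in> e})"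
    using vertex_degree_eq [OF assms] by (simp add: vertex_degree_def)
  also have "\<dots> = (\<Sum>e\<in>E. card {v \<in> V. v \<in> e})"
    by (rule sum_multicount_gen) (use fin in auto)
  also have "\<dots> = (\<Sum>e\<in>E. 2)"
  proof (rule sum.cong [OF refl])
    fix e assume "e \<in> E"
    then have "{v \<in> V. v \<in> e} = e" "card e = 2" using assms by (auto simp: simple_graph_def)
    then show "card {v \<in> V. v \<in> e} = 2" by simp
  qed
  finally show ?thesis by simp
qed

text \<open>What a minimal uncolorable graph provides to the discharging, stated without lists or
  colors.\<close>

locale sparse_configuration =
  fixes V :: "'a set" and E :: "'a set set" and k :: nat
  assumes graph: "simple_graph V E" and k: "6 \<le> k"
    and deg_ge: "\<And>v. v \<in> V \<Longrightarrow> 2 \<le> card (nbhd E v)"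
    and deg_le: "\<And>v. v \<in> V \<Longrightarrow> card (nbhd E v) \<le> k"
    and light_independent: "\<And>u v. u \<in> nbhd E v \<Longrightarrow> k \<le> weight E u \<or> k \<le> weight E v"
begin

abbreviation N where "N \<equiv> nbhd E"
abbreviation d where "d v \<equiv> card (nbhd E v)"
abbreviation q where "q \<equiv> weight E"

text \<open>The target average degree is \<open>2 + a\<close>. The constants satisfy \<open>1 = 5 a / 4 + 3 s\<close>, which makes
  every later estimate linear in \<open>a\<close> and \<open>s\<close>. A vertex of degree at least \<open>k - 1\<close> gives \<open>c\<close> to each
  neighbor, and a \<open>k\<close>-vertex also pays \<open>p\<close> into a pool, which exhausts its charge:
  \<open>k c + p = k - 2 - a\<close>. A thread of three 2-vertices lives on \<open>2 c + p = 3 a\<close>, a thread of two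
  2-vertices on \<open>b + c = 2 a\<close>.\<close>

definition s :: real where "s = 4 / (5 * real k + 2)"
definition a :: real where "a = (real k - 2) * s"
definition b :: real where "b = 3 * a / 4 + s"
definition c :: real where "c = 5 * a / 4 - s"
definition p :: real where "p = a / 2 + 2 * s"

text \<open>A vertex of degree 3 to 6 pays a 2-neighbor the part of its deficit \<open>a\<close>
  that the other neighbor, of degree \<open>z\<close>, leaves open. That neighbor sends
  \<open>c \<ge> a\<close> if \<open>z \<ge> k - 1\<close>, sends \<open>b \<ge> 3 * a / 4\<close>
  if \<open>z \<ge> 7\<close>, and in the symmetric case the two sides pay half each. For
  \<open>z = 2\<close> the next 2-vertex passes on \<open>c - a\<close>, and
  \<open>b + (c - a) = a\<close>.\<close>

definition thread_share :: "nat \<Rightarrow> real" where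
  "thread_share z = (if z = 2 then b else if k - 1 \<le> z then 0 else if 7 \<le> z then a / 4 else a / 2)"

text \<open>For a 2-vertex \<open>u\<close> next to \<open>v\<close>, the degree of the other neighbor of \<open>u\<close> is \<open>q u + 2 - d v\<close>.\<close>

definition give :: "'a \<Rightarrow> 'a \<Rightarrow> real" where
  "give v u =
    (if k - 1 \<le> d v then c
     else if 7 \<le> d v then b
     else if d v = 2 then (if d u = 2 \<and> q u < k then c - a else 0)
     else if d u = 2 then thread_share (q u + 2 - d v)
     else if d v = 3 then 0
     else if d v = 4 then (if d u = 3 then 2 * s else 0)
     else a / 4)"

definition final :: "'a \<Rightarrow> real" where
  "final v = real (d v) - 2 - a - (\<Sum>u\<in>N v. give v u) + (\<Sum>u\<in>N v. give u v)"

lemma s_pos: "0 < s" by (simp add: s_def)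

lemma one_eq: "1 = 5 * a / 4 + 3 * s"
proof -
  have "5 * real k + 2 \<noteq> 0" by linarith
  then have "s * (5 * real k + 2) = 4" using nonzero_eq_divide_eq [of "5 * real k + 2" s 4] s_def by blast
  then show ?thesis by (simp add: a_def field_simps)
qed

text \<open>Since \<open>a = (k - 2) * s\<close>, bounds on \<open>k\<close> become linear
  inequalities between \<open>a\<close> and \<open>s\<close>; this is how case distinctions on
  degrees reach linear arithmetic.\<close>

lemma a_ge: "n + 2 \<le> k \<Longrightarrow> n * s \<le> a" and a_le: "k \<le> n + 2 \<Longrightarrow> a \<le> n * s"
  using s_pos by (auto simp: a_def intro!: mult_right_mono)

lemma a_ge_4: "4 * s \<le> a" using a_ge [of 4] k by simp

lemmas params = s_pos one_eq a_ge_4 b_def c_def p_def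

lemma kc: "k * c + p = real k - 2 - a"
proof -
  have "real k * s = a + 2 * s" by (simp add: a_def algebra_simps)
  moreover have "real k - 2 = (real k - 2) * (5 * a / 4 + 3 * s)" using one_eq by simp
  then have "real k - 2 = 5 / 4 * (k * a) - 5 / 2 * a + 3 * (k * s) - 6 * s" by (simp add: field_simps)
  moreover have "real k * c = 5 / 4 * (k * a) - k * s" by (simp add: c_def algebra_simps)
  ultimately show ?thesis unfolding p_def by linarith
qed

lemma thread_share_bounds: "0 \<le> thread_share z" "thread_share z \<le> b"
  using params by (auto simp: thread_share_def)

lemma thread_share_le_half: "z \<noteq> 2 \<Longrightarrow> thread_share z \<le> a / 2"
  using params by (auto simp: thread_share_def)

lemma give_nonneg: "0 \<le> give v u"
  using thread_share_bounds(1) params by (auto simp: give_def)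

lemma N_sym: "u \<in> N v \<longleftrightarrow> v \<in> N u" by (rule nbhd_sym)

lemma finite_N [simp]: "finite (N v)" using finite_nbhd [OF graph] .

lemma N_in_V: "u \<in> N v \<Longrightarrow> u \<in> V" using nbhd_subset [OF graph] by blast

lemma received_ge: "S \<subseteq> N v \<Longrightarrow> (\<Sum>u\<in>S. give u v) \<le> (\<Sum>u\<in>N v. give u v)"
  by (rule sum_mono2) (use give_nonneg in auto)

lemma received_nonneg: "0 \<le> (\<Sum>u\<in>N v. give u v)"
  by (rule sum_nonneg) (use give_nonneg in auto)

lemma received_ge_one: "u \<in> N v \<Longrightarrow> give u v \<le> (\<Sum>u\<in>N v. give u v)"
  using received_ge [of "{u}" v] by simp

section \<open>Final charges by degree\<close>

lemma two_vertex:
  assumes "d u = 2" "x \<in> N u"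
  obtains y where "N u = {x, y}" "x \<noteq> y" "q u + 2 = d x + d y"
proof -
  obtain y where y: "N u = {x, y}" "x \<noteq> y" using assms by (metis card_2_iff insertE insert_commute singletonD)
  moreover have "2 \<le> d x" "2 \<le> d y" using y deg_ge N_in_V by auto
  ultimately show thesis using that by (simp add: weight_def)
qed

text \<open>A 2-vertex starts at \<open>-a\<close>. With a neighbor of degree at least
  \<open>k - 1\<close> it receives \<open>c\<close> and passes on at most \<open>c - a\<close>.
  Otherwise a 2-neighbor of it must be heavy, so it gives nothing away, and its two sides send at
  least \<open>a\<close> together. Only a middle vertex gets less, namely
  \<open>2 * (c - a)\<close>, which leaves it \<open>p\<close> short.\<close>

lemma final_two:
  assumes u: "u \<in> V" "d u = 2"
  shows "- (if \<forall>x\<in>N u. d x = 2 then p else 0) \<le> final u"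
proof -
  obtain x0 y0 where xy0: "N u = {x0, y0}" "x0 \<noteq> y0" using u(2) by (auto simp: card_2_iff)
  obtain x y where xy: "N u = {x, y}" "x \<noteq> y" "d y \<le> d x"
    using xy0 by (metis insert_commute linorder_linear)
  have qu: "q u + 2 = d x + d y" using two_vertex [of u x] u xy by (metis doubleton_eq_iff insertI1)
  have d2: "2 \<le> d x" "2 \<le> d y" using xy deg_ge N_in_V by auto
  have ux: "u \<in> N x" "u \<in> N y" using xy N_sym by blast+
  have fin: "final u = - a - (give u x + give u y) + (give x u + give y u)"
    using u xy by (simp add: final_def)
  have gu: "give u v = (if d v = 2 \<and> q v < k then c - a else 0)" for v
    using u k by (simp add: give_def)
  show ?thesis
  proof (cases "k - 1 \<le> d x")
    case True
    then have "give x u = c" by (simp add: give_def)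
    moreover have "give u x = 0" using True k gu by auto
    moreover have "give u y \<le> c - a" using gu params by auto
    ultimately show ?thesis using fin give_nonneg [of y u] params by auto
  next
    case dx: False
    have dy: "\<not> k - 1 \<le> d y" using dx xy by simp
    have "give u y = 0"
    proof (cases "d y = 2")
      case True
      then have "k \<le> q y" using light_independent [OF ux(2)] qu dx by linarith
      then show ?thesis using gu by auto
    qed (simp add: gu)
    moreover have "give u x = 0"
    proof (cases "d x = 2")
      case True
      then have "k \<le> q x" using light_independent [OF ux(1)] qu xy d2 k by linarith
      then show ?thesis using gu by auto
    qed (simp add: gu)
    ultimately have fin: "final u = - a + (give x u + give y u)" using fin by simp
    have zx: "q u + 2 - d x = d y" and zy: "q u + 2 - d y = d x" using qu by auto
    have light: "d y = 2 \<Longrightarrow> q u < k" using qu dx by linarith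
    have gx: "give x u = (if 7 \<le> d x then b else if d x = 2 then (if q u < k then c - a else 0) else thread_share (d y))"
      using dx u zx by (simp add: give_def)
    have gy: "give y u = (if 7 \<le> d y then b else if d y = 2 then (if q u < k then c - a else 0) else thread_share (d x))"
      using dy u zy by (simp add: give_def)
    consider "d x = 2" "d y = 2" | "2 < d x" "d y = 2" | "2 < d x" "2 < d y"
      using d2 xy by linarith
    then show ?thesis
    proof cases
      case 1
      then have "\<forall>x\<in>N u. d x = 2" using xy by auto
      moreover have "give x u = c - a" "give y u = c - a" using gx gy light 1 by auto
      ultimately show ?thesis using fin params by simp
    next
      case 2
      then have "give y u = c - a" "give x u = b" using gx gy light by (auto simp: thread_share_def)
      then show ?thesis using fin params by auto
    next
      case 3
      then have "a \<le> give x u + give y u"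
        using gx gy dx dy params by (auto simp: thread_share_def)
      then show ?thesis using fin params by auto
    qed
  qed
qed

lemma final_large:
  assumes v: "v \<in> V" "7 \<le> d v \<or> k - 1 \<le> d v"
  shows "(if d v = k then p else 0) \<le> final v"
proof -
  consider "d v = k" | "d v = k - 1" | "7 \<le> d v" "d v < k - 1"
    using v deg_le [of v] by linarith
  then show ?thesis
  proof cases
    case 1
    then have "(\<Sum>u\<in>N v. give v u) = k * c" by (simp add: give_def)
    then show ?thesis using 1 kc received_nonneg [of v] by (simp add: final_def)
  next
    case 2
    \<comment> \<open>The charge kept is at least \<open>p - (1 - c) = a / 2 - 2 * s\<close>,
      nonnegative because \<open>k \<ge> 6\<close>.\<close>
    then have "(\<Sum>u\<in>N v. give v u) = real (k - 1) * c" by (simp add: give_def)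
    also have "\<dots> = k * c - c" using k by (simp add: of_nat_diff algebra_simps)
    finally show ?thesis using 2 k kc received_nonneg [of v] params by (simp add: final_def of_nat_diff)
  next
    case 3
    then have "(\<Sum>u\<in>N v. give v u) = d v * b" by (simp add: give_def)
    \<comment> \<open>Degree 7 is the first at which paying \<open>b\<close> to all neighbors is
      affordable for every \<open>k\<close>: \<open>7 * (1 - b)\<close> exceeds \<open>2 + a\<close>
      by \<open>8 * s\<close>, while degree 6 would require \<open>a \<le> 12 * s\<close>.\<close>
    moreover have "7 * (1 - b) \<le> real (d v) * (1 - b)"
      using 3 params by (intro mult_right_mono) auto
    then have "7 - 7 * b \<le> real (d v) - d v * b" by (simp add: algebra_simps)
    moreover have "d v \<noteq> k" using 3 by linarith
    ultimately show ?thesis using 3 received_nonneg [of v] params by (simp add: final_def)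
  qed
qed

text \<open>If \<open>v\<close> is light, each 2-neighbor is heavy, so its other neighbor has degree
  at least \<open>k + 2 - d v\<close>. This is \<open>k - 1\<close> for a 3-vertex, and at least 7
  for a 4-vertex once \<open>k \<ge> 9\<close>, which makes the share small.\<close>

lemma small_gives:
  assumes v: "v \<in> V" "3 \<le> d v" "d v \<le> 6" "d v < k - 1" and u: "u \<in> N v"
  shows "d u = 2 \<Longrightarrow> give v u \<le> b"
    and "q v < k \<Longrightarrow> d u = 2 \<Longrightarrow> give v u \<le> (if d v = 3 then 0 else if d v = 4 \<and> 9 \<le> k then a / 4 else a / 2)"
    and "d u \<noteq> 2 \<Longrightarrow> give v u = (if d v = 3 then 0 else if d v = 4 then (if d u = 3 then 2 * s else 0) else a / 4)"
proof -
  have g: "d u = 2 \<Longrightarrow> give v u = thread_share (q u + 2 - d v)"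
    using v by (auto simp: give_def)
  then show "d u = 2 \<Longrightarrow> give v u \<le> b" using thread_share_bounds by simp
  show "d u \<noteq> 2 \<Longrightarrow> give v u = (if d v = 3 then 0 else if d v = 4 then (if d u = 3 then 2 * s else 0) else a / 4)"
    using v by (auto simp: give_def)
  assume qv: "q v < k" and du: "d u = 2"
  then have "k \<le> q u" using light_independent [OF u] by simp
  moreover have "q u + 2 - d v \<noteq> 2" using \<open>k \<le> q u\<close> v by linarith
  ultimately show "give v u \<le> (if d v = 3 then 0 else if d v = 4 \<and> 9 \<le> k then a / 4 else a / 2)"
    using g [OF du] thread_share_le_half [of "q u + 2 - d v"] v params by (auto simp: thread_share_def)
qed

lemma give_from_large:
  "k - 1 \<le> d w \<Longrightarrow> give w v = c" "7 \<le> d w \<Longrightarrow> b \<le> give w v"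
  using params by (auto simp: give_def)

lemma give_from_mid:
  assumes "d w < k - 1" "d v \<noteq> 2"
  shows "d w = 5 \<or> d w = 6 \<Longrightarrow> give w v = a / 4" "d w = 4 \<Longrightarrow> d v = 3 \<Longrightarrow> give w v = 2 * s"
  using assms by (auto simp: give_def)

text \<open>A light vertex pays little because its 2-neighbors are heavy. For a heavy vertex the
  weight forces large degrees in \<open>B\<close>: the more 2-neighbors it supports, the larger its
  other neighbors are and the more they send.\<close>

lemma final_small:
  assumes v: "v \<in> V" "3 \<le> d v" "d v \<le> 6" "d v < k - 1"
  shows "0 \<le> final v"
proof -
  define A where "A = {u \<in> N v. d u = 2}"
  define B where "B = {u \<in> N v. d u \<noteq> 2}"
  have AB: "N v = A \<union> B" "A \<inter> B = {}" "finite A" "finite B" by (auto simp: A_def B_def)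
  have cAB: "card A + card B = d v" using AB by (metis card_Un_disjoint)
  have split: "sum f (N v) = sum f A + sum f B" for f :: "'a \<Rightarrow> real"
    using AB by (metis sum.union_disjoint)
  note sg = small_gives [OF v]
  have gA: "sum (give v) A \<le> card A * b"
    by (rule sum_bounded_above [of A "give v" b]) (use sg(1) A_def in auto)
  have dB: "3 \<le> d w" if "w \<in> B" for w
    using that deg_ge [of w] N_in_V [of w v] by (auto simp: B_def)
  show ?thesis
  proof (cases "q v < k")
    case light: True
    \<comment> \<open>The entry for degree 4 and \<open>k \<ge> 9\<close> dominates both payments
      \<open>a / 4\<close> and \<open>2 * s\<close>, and four of it are affordable because
      \<open>a \<ge> 4 * s\<close>. For \<open>k \<le> 8\<close> the payment \<open>a / 2\<close> is
      affordable because \<open>a \<le> 6 * s\<close>.\<close>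
    define h where "h = (if d v = 3 then 0 else if d v = 4 then (if 9 \<le> k then a / 4 + 2 * s else a / 2) else a / 2)"
    have "give v u \<le> h" if "u \<in> N v" for u
      using sg(2) [OF that light] sg(3) [OF that] params unfolding h_def by (cases "d u = 2") (auto split: if_splits)
    then have le: "sum (give v) (N v) \<le> d v * h" using sum_bounded_above by blast
    consider "d v = 3" | "d v = 4" | "d v = 5" | "d v = 6" using v by linarith
    then have "d v * h \<le> real (d v) - 2 - a"
    proof cases
      case 2
      then show ?thesis using params a_le [of 6] by (cases "9 \<le> k") (auto simp: h_def)
    qed (use params in \<open>auto simp: h_def\<close>)
    then show ?thesis using le received_nonneg [of v] unfolding final_def by simp
  next
    case heavy: False
    have "q v = (\<Sum>u\<in>A. d u - 1) + (\<Sum>u\<in>B. d u - 1)"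
      unfolding weight_def using AB by (metis sum.union_disjoint)
    also have "(\<Sum>u\<in>A. d u - 1) = card A" by (simp add: A_def)
    finally have qv: "k \<le> card A + (\<Sum>u\<in>B. d u - 1)" using heavy by simp
    have Bne: "card B \<noteq> 0" using qv cAB v AB by auto
    have one: "\<exists>w. B = {w} \<and> k + 1 \<le> card A + d w" if "card B = 1"
      using that qv dB by (auto simp: card_1_singleton_iff)
    have final: "final v = real (d v) - 2 - a - sum (give v) A - sum (give v) B + (\<Sum>u\<in>N v. give u v)"
      unfolding final_def split by simp
    have gB: "sum (give v) B \<le> card B * h" if "\<And>u. u \<in> B \<Longrightarrow> give v u \<le> h" for h :: real
      by (rule sum_bounded_above) (rule that)
    consider "d v = 3" | "d v = 4" | "d v = 5" | "d v = 6" using v by linarith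
    then show ?thesis
    proof cases
      case 1
      have "give v u \<le> 0" if "u \<in> B" for u using sg(3) that 1 by (auto simp: B_def)
      from gB [OF this] have B0: "sum (give v) B \<le> 0" by simp
      consider "card A = 0" | "card A = 1" "card B = 2" | "card A = 2" "card B = 1"
        using cAB Bne 1 by linarith
      then show ?thesis
      proof cases
        case 1
        then show ?thesis using final B0 gA \<open>d v = 3\<close> received_nonneg [of v] params by simp
      next
        case 3
        \<comment> \<open>A tight case: \<open>1 - a - 2 * b + c = 0\<close>.\<close>
        then obtain w where w: "B = {w}" "k - 1 \<le> d w" using one by fastforce
        then have "give w v = c" "w \<in> N v" using give_from_large(1) AB by auto
        then show ?thesis using final B0 gA \<open>d v = 3\<close> 3 received_ge_one [of w v] params by simp
      next
        case 2
        then obtain w0 w1 where "B = {w0, w1}" "w0 \<noteq> w1" by (auto simp: card_2_iff)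
        then obtain w w' where w: "B = {w, w'}" "w \<noteq> w'" "d w' \<le> d w"
          by (metis insert_commute linorder_linear)
        have dw: "3 \<le> d w" "3 \<le> d w'" using w dB by auto
        have sum: "k + 1 \<le> d w + d w'" using qv w 2 dw by simp
        have rec: "give w v + give w' v \<le> (\<Sum>u\<in>N v. give u v)"
          using received_ge [of B v] w AB by simp
        \<comment> \<open>The deficit is \<open>b - (1 - a)\<close>. If both neighbors are small,
          \<open>k + 1 \<le> d w + d w'\<close> bounds \<open>k\<close>, and with it
          \<open>a\<close> by a small multiple of \<open>s\<close>.\<close>
        have "a / 2 - 2 * s \<le> give w v + give w' v"
        proof (cases "k - 1 \<le> d w \<or> 7 \<le> d w")
          case True
          then show ?thesis
            using give_from_large [of w v] give_nonneg [of w' v] params by auto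
        next
          case False
          then have lt: "d w < k - 1" "d w' < k - 1" "d w \<le> 6" "d w' \<le> 6" using w by auto
          have ne: "d v \<noteq> 2" using \<open>d v = 3\<close> by simp
          note g = give_from_mid [OF lt(1) ne] give_from_mid [OF lt(2) ne]
          have nn: "0 \<le> give w v" "0 \<le> give w' v" using give_nonneg by auto
          consider "5 \<le> d w" "5 \<le> d w'" | "5 \<le> d w" "d w' \<le> 4" | "d w = 4" "d w' = 4" | "d w = 4" "d w' = 3"
            using w dw sum k by linarith
          then show ?thesis
          proof cases
            case 1
            then have "d w = 5 \<or> d w = 6" "d w' = 5 \<or> d w' = 6" using lt by linarith+
            then have "give w v = a / 4" "give w' v = a / 4" using g by blast+
            then show ?thesis using params by simp
          next
            case 2
            then have "d w = 5 \<or> d w = 6" using lt by linarith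
            then have "give w v = a / 4" using g by blast
            moreover have "a \<le> 7 * s" using a_le [of 7] sum lt 2 by simp
            ultimately show ?thesis using nn params by simp
          next
            case 3
            then have "give w v = 2 * s" "give w' v = 2 * s" using g \<open>d v = 3\<close> by auto
            moreover have "a \<le> 5 * s" using a_le [of 5] sum 3 by simp
            ultimately show ?thesis using params by simp
          next
            case 4
            then have "a \<le> 4 * s" using a_le [of 4] sum by simp
            then show ?thesis using nn params by simp
          qed
        qed
        then show ?thesis using final B0 gA \<open>d v = 3\<close> 2 rec params by simp
      qed
    next
      case 2
      consider "card A \<le> 2" | "card A = 3" "card B = 1" using cAB Bne 2 by linarith
      then show ?thesis
      proof cases
        case 1
        \<comment> \<open>The amount \<open>2 * s\<close> is what a 4-vertex with two 2-neighbors
          can spare for each of two 3-neighbors: \<open>2 - a - 2 * b - 4 * s = 0\<close>.\<close>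
        have "give v u \<le> 2 * s" if "u \<in> B" for u using sg(3) that 2 params by (auto simp: B_def)
        from gB [OF this] have B: "sum (give v) B \<le> card B * (2 * s)" .
        consider "card A = 0" "card B = 4" | "card A = 1" "card B = 3" | "card A = 2" "card B = 2"
          using 1 cAB 2 by linarith
        then show ?thesis using final B gA \<open>d v = 4\<close> received_nonneg [of v] params by cases auto
      next
        case t: 2
        then obtain w where w: "B = {w}" "k - 2 \<le> d w" using one by fastforce
        have "d w \<noteq> 3" using w k by linarith
        then have "sum (give v) B = 0" using sg(3) [of w] 2 w by (auto simp: B_def)
        \<comment> \<open>The deficit left by three 2-neighbors,
          \<open>3 * b - (2 - a)\<close>.\<close>
        moreover have "3 * a / 4 - 3 * s \<le> give w v"
        proof (cases "k - 1 \<le> d w \<or> 7 \<le> d w")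
          case True
          then show ?thesis using give_from_large [of w v] params by auto
        next
          case False
          then have dw: "d w = k - 2" "d w \<le> 6" using w by auto
          have lt: "d w < k - 1" using dw k by linarith
          have "d w = 4 \<or> d w = 5 \<or> d w = 6" using dw k by linarith
          then show ?thesis
          proof (cases "d w = 4")
            case True
            then have "a \<le> 4 * s" using a_le [of 4] dw by simp
            then show ?thesis using give_nonneg [of w v] by simp
          next
            case False
            then have "give w v = a / 4" using give_from_mid [OF lt, of v] \<open>d w = 4 \<or> _\<close> 2 by auto
            moreover have "a \<le> 6 * s" using a_le [of 6] dw by simp
            ultimately show ?thesis by simp
          qed
        qed
        moreover have "w \<in> N v" using w AB by auto
        ultimately show ?thesis using final gA \<open>d v = 4\<close> t received_ge_one [of w v] params by simp
      qed
    next
      case 3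
      have "give v u \<le> a / 4" if "u \<in> B" for u using sg(3) that 3 by (auto simp: B_def)
      from gB [OF this] have B: "sum (give v) B \<le> card B * (a / 4)" .
      consider "card A = 0" "card B = 5" | "card A = 1" "card B = 4" | "card A = 2" "card B = 3" | "card A = 3" "card B = 2"
        | "card A = 4" "card B = 1" using cAB Bne 3 by linarith
      then show ?thesis
      proof cases
        case 5
        then obtain w where w: "B = {w}" "k - 3 \<le> d w" using one by fastforce
        then have wN: "w \<in> N v" using AB by auto
        \<comment> \<open>The deficit \<open>4 * b + a / 4 - (3 - a)\<close>. It is not positive for
          \<open>k \<le> 12\<close>; beyond that, \<open>w\<close> has degree at least
          \<open>k - 3 \<ge> 10\<close> and sends at least \<open>b\<close>.\<close>
        have "a / 2 - 5 * s \<le> (\<Sum>u\<in>N v. give u v)"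
        proof (cases "k \<le> 12")
          case True
          then show ?thesis using a_le [of 10] received_nonneg [of v] by simp
        next
          case False
          then have "b \<le> give w v" using w give_from_large(2) by simp
          then show ?thesis using received_ge_one [OF wN] params by simp
        qed
        then show ?thesis using final B gA \<open>d v = 5\<close> 5 params by simp
      qed (use final B gA \<open>d v = 5\<close> received_nonneg [of v] params in auto)
    next
      case 4
      have "give v u \<le> a / 4" if "u \<in> B" for u using sg(3) that 4 by (auto simp: B_def)
      from gB [OF this] have B: "sum (give v) B \<le> card B * (a / 4)" .
      have "card A \<le> 5" and cB: "real (card B) = 6 - real (card A)" using cAB Bne 4 by linarith+
      then have "real (card A) * (b - a / 4) \<le> 5 * (b - a / 4)"
        using params by (intro mult_right_mono) auto
      then have "real (card A) * b + card B * (a / 4) \<le> 5 * b + a / 4"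
        unfolding cB by (simp add: algebra_simps)
      then show ?thesis
        using final B gA \<open>d v = 6\<close> received_nonneg [of v] params by simp
    qed
  qed
qed

section \<open>Summation of the charges and the pool\<close>

lemma final_bound:
  assumes "v \<in> V"
  shows "(if d v = k then p else 0) - (if d v = 2 \<and> (\<forall>x\<in>N v. d x = 2) then p else 0) \<le> final v"
proof -
  consider "d v = 2" | "3 \<le> d v" "d v \<le> 6" "d v < k - 1" | "7 \<le> d v \<or> k - 1 \<le> d v"
    using deg_ge [OF assms] by linarith
  then show ?thesis
  proof cases
    case 1
    then show ?thesis using final_two [OF assms 1] k by auto
  next
    case 2
    then show ?thesis using final_small [OF assms 2] by auto
  next
    case 3
    then show ?thesis using final_large [OF assms 3] k by auto
  qed
qed

lemma sum_final: "(\<Sum>v\<in>V. final v) = 2 * card E - (2 + a) * card V"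
proof -
  have finV: "finite V" using graph by (simp add: simple_graph_def)
  have Ns: "N v = {u. u \<in> V \<and> {u, v} \<in> E}" for v using N_in_V by (auto simp: nbhd_def)
  have "(\<Sum>v\<in>V. \<Sum>u\<in>N v. give v u) = (\<Sum>v\<in>V. \<Sum>u\<in>N v. give u v)"
    unfolding Ns using sum.swap_restrict [OF finV finV, of give "\<lambda>v u. {u, v} \<in> E"] by (simp add: insert_commute)
  moreover have "(\<Sum>v\<in>V. real (d v)) = 2 * card E"
    using sum_card_nbhd [OF graph] by (metis of_nat_mult of_nat_numeral of_nat_sum)
  ultimately show ?thesis
    unfolding final_def by (simp add: sum.distrib sum_subtractf algebra_simps)
qed

theorem average_degree_ge:
  assumes "card {v \<in> V. d v = 2 \<and> (\<forall>x\<in>N v. d x = 2)} \<le> card {v \<in> V. d v = k}"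
  shows "(2 + (4 * real k - 8) / (5 * real k + 2)) * card V \<le> 2 * card E"
proof -
  let ?M = "{v \<in> V. d v = 2 \<and> (\<forall>x\<in>N v. d x = 2)}" and ?K = "{v \<in> V. d v = k}"
  have finV: "finite V" using graph by (simp add: simple_graph_def)
  have "0 \<le> p * (real (card ?K) - card ?M)" using assms params by simp
  also have "\<dots> = (\<Sum>v\<in>V. (if d v = k then p else 0) - (if d v = 2 \<and> (\<forall>x\<in>N v. d x = 2) then p else 0))"
    using finV by (simp add: sum_subtractf sum.If_cases Int_def algebra_simps)
  also have "\<dots> \<le> (\<Sum>v\<in>V. final v)" by (rule sum_mono) (rule final_bound)
  finally have "(2 + a) * card V \<le> 2 * card E" using sum_final by simp
  moreover have "a = (4 * real k - 8) / (5 * real k + 2)"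
    by (simp add: a_def s_def algebra_simps)
  ultimately show ?thesis by simp
qed

end

section \<open>Reducible configurations\<close>

definition conflict :: "'a set set \<Rightarrow> 'a \<Rightarrow> 'a \<Rightarrow> bool" where
  "conflict E u v \<longleftrightarrow> u \<noteq> v \<and> (\<exists>w. u \<in> nbhd E w \<and> v \<in> nbhd E w)"

text \<open>Conflicts are always those of the whole edge set, also on a partial domain
  \<open>A\<close>; uncoloring vertices thus only shrinks \<open>A\<close>.\<close>

definition list_coloring_on :: "'a set set \<Rightarrow> ('a \<Rightarrow> 'c set) \<Rightarrow> 'a set \<Rightarrow> ('a \<Rightarrow> 'c) \<Rightarrow> bool" where
  "list_coloring_on E L A f \<longleftrightarrow>
     (\<forall>v\<in>A. f v \<in> L v) \<and> (\<forall>u\<in>A. \<forall>v\<in>A. conflict E u v \<longrightarrow> f u \<noteq> f v)"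

lemma conflict_sym: "conflict E u v \<longleftrightarrow> conflict E v u"
  unfolding conflict_def by blast

lemma conflict_irrefl: "\<not> conflict E u u"
  unfolding conflict_def by blast

lemma conflict_iff:
  "conflict E u v \<longleftrightarrow> u \<noteq> v \<and> (\<exists>w\<in>nbhd E u. v \<in> nbhd E w)"
  unfolding conflict_def by (metis nbhd_sym)

lemma list_coloring_on_subset: "list_coloring_on E L A f \<Longrightarrow> B \<subseteq> A \<Longrightarrow> list_coloring_on E L B f"
  unfolding list_coloring_on_def by blast

lemma injective_coloring_iff:
  assumes "simple_graph V E"
  shows "injective_coloring V E f \<longleftrightarrow> (\<forall>u\<in>V. \<forall>v\<in>V. conflict E u v \<longrightarrow> f u \<noteq> f v)"
proof -
  have "(\<exists>w\<in>V. {u, w} \<in> E \<and> {v, w} \<in> E) \<longleftrightarrow> (\<exists>w. u \<in> nbhd E w \<and> v \<in> nbhd E w)" for u v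
    using assms unfolding nbhd_def simple_graph_def mem_Collect_eq by (metis insert_subset)
  then show ?thesis unfolding injective_coloring_def conflict_def by blast
qed

lemma card_conflicts_le:
  assumes "simple_graph V E"
  shows "finite {u. conflict E v u}" "card {u. conflict E v u} \<le> weight E v"
proof -
  have eq: "{u. conflict E v u} = (\<Union>w\<in>nbhd E v. nbhd E w - {v})"
    unfolding conflict_iff by blast
  show "finite {u. conflict E v u}"
    unfolding eq using finite_nbhd [OF assms] by auto
  have "card {u. conflict E v u} \<le> (\<Sum>w\<in>nbhd E v. card (nbhd E w - {v}))"
    unfolding eq using finite_nbhd [OF assms] by (intro card_UN_le)
  also have "\<dots> = weight E v"
    unfolding weight_def using finite_nbhd [OF assms]
    by (intro sum.cong refl card_Diff_singleton) (auto simp: nbhd_sym)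
  finally show "card {u. conflict E v u} \<le> weight E v" .
qed

section \<open>Extending and repairing list colorings\<close>

lemma list_coloring_extend:
  assumes G: "simple_graph V E" and f: "list_coloring_on E L A f"
    and L: "weight E v < card (L v)"
  shows "\<exists>g. list_coloring_on E L (insert v A) g"
proof -
  have "card (f ` {u. conflict E v u}) < card (L v)"
    using card_image_le [OF card_conflicts_le(1) [OF G], of f v] card_conflicts_le(2) [OF G, of v] L by linarith
  then have "\<not> L v \<subseteq> f ` {u. conflict E v u}"
    using card_mono [OF finite_imageI [OF card_conflicts_le(1) [OF G]]] by (metis not_less)
  then obtain col where c: "col \<in> L v" "\<And>u. conflict E v u \<Longrightarrow> col \<noteq> f u" by blast
  have "list_coloring_on E L (insert v A) (f(v := col))"
    unfolding list_coloring_on_def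
  proof (intro conjI ballI impI)
    show "(f(v := col)) u \<in> L u" if "u \<in> insert v A" for u
      using that c(1) f unfolding list_coloring_on_def by auto
    show "(f(v := col)) u \<noteq> (f(v := col)) w"
      if "u \<in> insert v A" "w \<in> insert v A" "conflict E u w" for u w
    proof -
      have "u \<noteq> w" using that conflict_irrefl by metis
      then show ?thesis
        using that c(2) [of w] c(2) [of u] f conflict_sym [of E u v] unfolding list_coloring_on_def
        by (cases "u = v"; cases "w = v") auto
    qed
  qed
  then show ?thesis by blast
qed

lemma list_coloring_extend_set:
  assumes G: "simple_graph V E" and "finite C" and f: "list_coloring_on E L A f"
    and L: "\<And>v. v \<in> C \<Longrightarrow> weight E v < card (L v)"
  shows "\<exists>g. list_coloring_on E L (C \<union> A) g"
  using assms(2) L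
proof (induction C rule: finite_induct)
  case empty
  then show ?case using f by auto
next
  case (insert v C)
  then obtain g where "list_coloring_on E L (C \<union> A) g" by auto
  from list_coloring_extend [OF G this] show ?case using insert.prems by auto
qed

text \<open>A conflict lost with the edge comes from a path of length two using it, so
  \<open>x\<close> or \<open>y\<close> is one of the two conflicting vertices. Uncoloring both ends
  repairs everything.\<close>

lemma list_coloring_delete_edge:
  "list_coloring_on (E - {{x, y}}) L A f \<Longrightarrow> list_coloring_on E L (A - {x, y}) f"
proof -
  have "conflict (E - {{x, y}}) u v" if "conflict E u v" "u \<notin> {x, y}" "v \<notin> {x, y}" for u v
    using that unfolding conflict_def nbhd_def by (auto simp: doubleton_eq_iff)
  then show "list_coloring_on (E - {{x, y}}) L A f \<Longrightarrow> list_coloring_on E L (A - {x, y}) f"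
    unfolding list_coloring_on_def by blast
qed

text \<open>Shrink the lists to two colors. If all agree, alternate the colors, which closes up
  because the length is even. Otherwise two consecutive lists differ, and a greedy coloring started
  there succeeds.\<close>

lemma even_cycle_list_coloring:
  fixes \<Lambda> :: "nat \<Rightarrow> 'c set"
  assumes n: "0 < n" and L: "\<And>i. i < 2 * n \<Longrightarrow> 2 \<le> card (\<Lambda> i)"
  shows "\<exists>h. \<forall>i < 2 * n. h i \<in> \<Lambda> i \<and> h i \<noteq> h (Suc i mod (2 * n))"
proof -
  have "\<exists>T. T \<subseteq> \<Lambda> i \<and> card T = 2" if "i < 2 * n" for i
    using obtain_subset_with_card_n [OF L [OF that]] by metis
  then obtain T where T: "\<And>i. i < 2 * n \<Longrightarrow> T i \<subseteq> \<Lambda> i" "\<And>i. i < 2 * n \<Longrightarrow> card (T i) = 2"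
    by metis
  show ?thesis
  proof (cases "\<forall>i. Suc i < 2 * n \<longrightarrow> T i = T (Suc i)")
    case True
    have all: "i < 2 * n \<Longrightarrow> T i = T 0" for i by (induction i) (use True in auto)
    obtain x y where xy: "T 0 = {x, y}" "x \<noteq> y" using T(2) [of 0] n by (auto simp: card_2_iff)
    define h where "h i = (if even i then x else y)" for i :: nat
    have "h i \<in> \<Lambda> i \<and> h i \<noteq> h (Suc i mod (2 * n))" if i: "i < 2 * n" for i
    proof
      show "h i \<in> \<Lambda> i" using all [OF i] T(1) [OF i] xy by (auto simp: h_def)
      show "h i \<noteq> h (Suc i mod (2 * n))"
      proof (cases "Suc i < 2 * n")
        case False
        then have "Suc i = 2 * n" using i by simp
        moreover from this have "odd i" by (metis dvd_triv_left even_Suc)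
        ultimately show ?thesis using xy by (simp add: h_def)
      qed (use xy in \<open>simp add: h_def\<close>)
    qed
    then show ?thesis by blast
  next
    case False
    then obtain i where i: "Suc i < 2 * n" "T i \<noteq> T (Suc i)" by blast
    have "\<not> T i \<subseteq> T (Suc i)"
      using i T(2) [of i] T(2) [of "Suc i"] card_subset_eq [of "T (Suc i)" "T i"]
      by (metis Suc_lessD card.infinite zero_neq_numeral)
    then obtain x where x: "x \<in> T i" "x \<notin> T (Suc i)" by blast
    text \<open>Color backwards around the cycle, starting with \<open>x\<close> at position \<open>i\<close>; the last position
      \<open>Suc i\<close> cannot clash with \<open>x\<close>.\<close>
    define \<rho> where "\<rho> j = (if j \<le> i then i - j else i + 2 * n - j)" for j
    define g where "g = rec_nat x (\<lambda>j r. SOME z. z \<in> T (\<rho> (Suc j)) \<and> z \<noteq> r)"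
    have g0: "g 0 = x" by (simp add: g_def)
    have gS: "g (Suc j) \<in> T (\<rho> (Suc j)) \<and> g (Suc j) \<noteq> g j" if "Suc j < 2 * n" for j
    proof -
      have "\<rho> (Suc j) < 2 * n" using that i by (auto simp: \<rho>_def)
      then have "card (T (\<rho> (Suc j))) = 2" by (rule T(2))
      then have "\<exists>z. z \<in> T (\<rho> (Suc j)) \<and> z \<noteq> g j" by (auto simp: card_2_iff)
      from someI_ex [OF this] show ?thesis by (simp add: g_def)
    qed
    have gT: "g j \<in> T (\<rho> j)" if "j < 2 * n" for j
      using that gS g0 x(1) by (cases j) (auto simp: \<rho>_def)
    define h where "h t = g (\<rho> t)" for t
    \<comment> \<open>\<open>\<rho>\<close> is the reflection of \<open>t\<close> to
      \<open>i - t\<close> modulo \<open>2 * n\<close>; as an involution it translates the order of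
      coloring into positions and back.\<close>
    have \<rho>: "\<rho> t < 2 * n" "\<rho> (\<rho> t) = t" if "t < 2 * n" for t
      using that i by (auto simp: \<rho>_def)
    have "h t \<in> \<Lambda> t \<and> h t \<noteq> h (Suc t mod (2 * n))" if t: "t < 2 * n" for t
    proof
      show "h t \<in> \<Lambda> t" using gT [OF \<rho>(1) [OF t]] \<rho>(2) [OF t] T(1) [OF t] by (auto simp: h_def)
      show "h t \<noteq> h (Suc t mod (2 * n))"
      proof (cases "t = i")
        case True
        have "h (Suc i) \<in> T (Suc i)" using gT [OF \<rho>(1) [OF i(1)]] \<rho>(2) [OF i(1)] by (simp add: h_def)
        moreover have "h i = x" using g0 by (simp add: h_def \<rho>_def)
        ultimately show ?thesis using True i x by auto
      next
        case False
        have "\<rho> t = Suc (\<rho> (Suc t mod (2 * n)))"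
        proof (cases "Suc t < 2 * n")
          case True
          then show ?thesis using False i by (auto simp: \<rho>_def)
        next
          case False
          then have "Suc t = 2 * n" using t by simp
          then show ?thesis using i \<open>t \<noteq> i\<close> by (auto simp: \<rho>_def)
        qed
        then show ?thesis using gS [of "\<rho> (Suc t mod (2 * n))"] \<rho>(1) [OF t] by (auto simp: h_def)
      qed
    qed
    then show ?thesis by blast
  qed
qed

context sparse_configuration
begin

section \<open>Closed chains of threads\<close>

definition middles :: "'a set" where
  "middles = {v \<in> V. d v = 2 \<and> (\<forall>x\<in>N v. d x = 2)}"

lemma middle_weight: "m \<in> middles \<Longrightarrow> q m = 2"
  unfolding middles_def weight_def by simp

text \<open>A middle vertex has weight 2 and is light, so its neighbor \<open>u\<close> is heavy.
  The weight of \<open>u\<close> is \<open>1 + (d x - 1) = d x\<close>, hence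
  \<open>d x = k\<close>.\<close>

lemma thread_end:
  assumes "m \<in> middles" "u \<in> N m"
  shows "\<exists>x w. N u = {m, x} \<and> m \<noteq> x \<and> d x = k \<and> N m = {u, w} \<and> w \<noteq> u"
proof -
  have d2: "d u = 2" "d m = 2" using assms by (auto simp: middles_def)
  have "m \<in> N u" using assms N_sym by blast
  then obtain x where x: "N u = {m, x}" "m \<noteq> x" "q u + 2 = d m + d x"
    using two_vertex [OF d2(1)] by metis
  obtain w where w: "N m = {u, w}" "u \<noteq> w" using two_vertex [OF d2(2) assms(2)] by metis
  have "k \<le> q u" using light_independent [OF assms(2)] middle_weight [OF assms(1)] k by linarith
  then have "d x = k" using x d2 deg_le [of x] N_in_V [of x u] by auto
  then show ?thesis using x w by metis
qed

text \<open>A cycle in the multigraph of threads on their hubs, loops and parallel edges included.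
  The two ends of the \<open>t\<close>-th thread are \<open>v (2 * t)\<close> and
  \<open>v (2 * t + 1)\<close>. The sequence runs on past the cycle, so the equations hold for all
  \<open>t\<close> without modular indices; at \<open>2 * n\<close> only the hub has to return, not
  the vertex.\<close>

lemma thread_cycle_exists:
  assumes "card {v \<in> V. d v = k} < card middles"
  obtains n :: nat and v :: "nat \<Rightarrow> 'a" and ctr hub mate :: "'a \<Rightarrow> 'a"
  where "0 < n" "inj_on v {..<2 * n}"
    "\<And>t. ctr (v t) \<in> middles" "\<And>t. N (v t) = {ctr (v t), hub (v t)}" "\<And>t. d (hub (v t)) = k"
    "\<And>t. N (ctr (v t)) = {v t, mate (v t)}"
    "\<And>t. mate (v (2 * t)) = v (2 * t + 1)" "\<And>t. mate (v (2 * t + 1)) = v (2 * t)"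
    "\<And>t. hub (v (2 * t + 1)) = hub (v (2 * t + 2))" "hub (v 0) = hub (v (2 * n - 1))"
    "\<And>t t'. t < n \<Longrightarrow> t' < n \<Longrightarrow> hub (v (2 * t)) = hub (v (2 * t')) \<Longrightarrow> t = t'"
proof -
  let ?ends = "\<lambda>S. \<Union>m\<in>S. N m"
  have finV: "finite V" using graph by (simp add: simple_graph_def)
  have finM: "finite middles" using finV by (simp add: middles_def)
  have "\<forall>u\<in>?ends middles. \<exists>m x w. m \<in> middles \<and> N u = {m, x} \<and> m \<noteq> x \<and> d x = k \<and> N m = {u, w} \<and> w \<noteq> u"
    using thread_end by blast
  then obtain ctr hub mate where
    C: "\<And>u. u \<in> ?ends middles \<Longrightarrow> ctr u \<in> middles \<and> N u = {ctr u, hub u} \<and> ctr u \<noteq> hub u \<and>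
          d (hub u) = k \<and> N (ctr u) = {u, mate u} \<and> mate u \<noteq> u"
    by metis
  have ctr_eq: "ctr u = m" if "m \<in> middles" "u \<in> N m" for u m
  proof -
    have "u \<in> ?ends middles" using that by blast
    moreover have "m \<in> N u" using that N_sym by blast
    moreover have "d m = 2" using that by (simp add: middles_def)
    ultimately show ?thesis using C [of u] k by auto
  qed
  have mate: "mate u \<in> N (ctr u)" "mate (mate u) = u" "ctr (mate u) = ctr u" if "u \<in> ?ends middles" for u
  proof -
    show 1: "mate u \<in> N (ctr u)" using C [OF that] by blast
    then show 2: "ctr (mate u) = ctr u" using ctr_eq C [OF that] by blast
    have "mate u \<in> ?ends middles" using 1 C [OF that] by blast
    then have "N (ctr u) = {mate u, mate (mate u)}" using C 2 by metis
    then show "mate (mate u) = u" using C [OF that] by (metis doubleton_eq_iff)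
  qed
  define \<F> where "\<F> = {S. S \<subseteq> middles \<and> S \<noteq> {} \<and> card (hub ` ?ends S) \<le> card S}"
  have "hub ` ?ends middles \<subseteq> {v \<in> V. d v = k}"
  proof
    fix x assume "x \<in> hub ` ?ends middles"
    then obtain u where u: "u \<in> ?ends middles" "x = hub u" by blast
    then have "x \<in> N u" "d x = k" using C [OF u(1)] by auto
    then show "x \<in> {v \<in> V. d v = k}" using N_in_V by blast
  qed
  then have "card (hub ` ?ends middles) \<le> card {v \<in> V. d v = k}"
    using finV by (intro card_mono) auto
  then have "middles \<in> \<F>" using assms by (auto simp: \<F>_def)
  moreover have "finite \<F>" using finM by (simp add: \<F>_def)
  ultimately obtain S where S: "S \<in> \<F>" and min: "\<And>S'. S' \<in> \<F> \<Longrightarrow> S' \<subseteq> S \<Longrightarrow> S = S'"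
    using finite_has_minimal [of \<F>] by blast
  have SM: "S \<subseteq> middles" "S \<noteq> {}" "card (hub ` ?ends S) \<le> card S" using S by (auto simp: \<F>_def)
  have sub: "?ends S \<subseteq> ?ends middles" using SM by blast
  have "finite S" using finite_subset [OF SM(1) finM] .
  then have finS: "finite S" "finite (?ends S)" by auto
  have ctrS: "ctr u \<in> S" if u: "u \<in> ?ends S" for u
  proof -
    obtain m where "m \<in> S" "u \<in> N m" using u by blast
    then show ?thesis using ctr_eq [of m u] SM(1) by auto
  qed
  text \<open>By minimality of \<open>S\<close>, no hub carries just one thread end of \<open>S\<close>; this is what makes it
    possible to walk on from thread to thread.\<close>
  have "\<exists>u'\<in>?ends S. u' \<noteq> u \<and> hub u' = hub u" if u: "u \<in> ?ends S" for u
  proof (rule ccontr)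
    assume no: "\<not> ?thesis"
    define S' where "S' = S - {ctr u}"
    show False
    proof (cases "S' = {}")
      case True
      then have "S = {ctr u}" using ctrS [OF u] S'_def by blast
      moreover have "N (ctr u) = {u, mate u}" using C sub u by blast
      ultimately have "card (hub ` {u, mate u}) \<le> 1" using SM(3) by simp
      then have "hub (mate u) = hub u" by (cases "hub u = hub (mate u)") auto
      moreover have "u \<in> ?ends middles" using u sub by blast
      then have "mate u \<in> ?ends S" "mate u \<noteq> u" using mate(1) [of u] C [of u] ctrS [OF u] by blast+
      ultimately show False using no by blast
    next
      case False
      have "hub ` ?ends S' \<subseteq> hub ` ?ends S - {hub u}"
      proof
        fix x assume "x \<in> hub ` ?ends S'"
        then obtain w m where w: "x = hub w" "m \<in> S'" "w \<in> N m" by blast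
        then have "w \<in> ?ends S" "ctr w \<noteq> ctr u" using ctr_eq [of m w] SM unfolding S'_def by auto
        moreover from this have "w \<noteq> u" by blast
        ultimately have "hub w \<noteq> hub u" using no by blast
        then show "x \<in> hub ` ?ends S - {hub u}"
          unfolding w(1) using \<open>w \<in> ?ends S\<close> by (intro DiffI imageI) simp_all
      qed
      then have "card (hub ` ?ends S') \<le> card (hub ` ?ends S - {hub u})"
        using finS by (intro card_mono) auto
      also have "\<dots> = card (hub ` ?ends S) - 1" using u by (intro card_Diff_singleton) blast
      also have "\<dots> \<le> card S'" unfolding S'_def using SM(3) ctrS [OF u] finS by simp
      finally have "S' \<in> \<F>" using False SM S'_def by (auto simp: \<F>_def)
      then show False using min [of S'] ctrS [OF u] S'_def by blast
    qed
  qed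
  then obtain \<tau> where \<tau>: "\<And>u. u \<in> ?ends S \<Longrightarrow> \<tau> u \<in> ?ends S \<and> \<tau> u \<noteq> u \<and> hub (\<tau> u) = hub u"
    by metis
  have mateS: "mate u \<in> ?ends S" if "u \<in> ?ends S" for u
    using mate(1) [of u] sub ctrS [OF that] that by blast
  obtain u0 where u0: "u0 \<in> ?ends S"
  proof -
    obtain m where "m \<in> S" using SM by blast
    then have "d m = 2" using SM by (auto simp: middles_def)
    then have "N m \<noteq> {}" by auto
    then show thesis using that \<open>m \<in> S\<close> by blast
  qed
  \<comment> \<open>\<open>mate\<close> crosses a thread and \<open>\<tau>\<close> changes to a
    different end at the hub reached, so the walk never turns back.\<close>
  define e where "e i = ((\<lambda>u. \<tau> (mate u)) ^^ i) u0" for i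
  have eS: "e i \<in> ?ends S" for i
    by (induction i) (use u0 \<tau> mateS in \<open>auto simp: e_def\<close>)
  have eSuc: "e (Suc i) = \<tau> (mate (e i))" for i by (simp add: e_def)
  have hubS: "hub (mate (e i)) = hub (e (Suc i))" for i
    using \<tau> mateS eS eSuc by metis
  have neS: "e (Suc i) \<noteq> mate (e i)" for i
    using \<tau> mateS eS eSuc by metis
  have "\<not> inj (\<lambda>i. hub (e i))"
  proof
    assume "inj (\<lambda>i. hub (e i))"
    moreover have "range (\<lambda>i. hub (e i)) \<subseteq> hub ` ?ends S" using eS by blast
    ultimately show False using finS by (meson finite_imageI finite_subset range_inj_infinite)
  qed
  then obtain i j where "i < j" "hub (e i) = hub (e j)"
    unfolding inj_def by (metis linorder_neqE_nat)
  then have ex: "\<exists>n. 0 < n \<and> (\<exists>i. hub (e i) = hub (e (i + n)))"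
    by (intro exI [of _ "j - i"] conjI exI [of _ i]) auto
  \<comment> \<open>Minimal over all starting points, so that any \<open>n\<close> consecutive hubs
    are distinct.\<close>
  define n where "n = (LEAST n. 0 < n \<and> (\<exists>i. hub (e i) = hub (e (i + n))))"
  from LeastI_ex [OF ex] obtain i where n: "0 < n" "hub (e i) = hub (e (i + n))" unfolding n_def by blast
  have least: "hub (e l) \<noteq> hub (e (l + r))" if "0 < r" "r < n" for l r
    using not_less_Least [of r "\<lambda>n. 0 < n \<and> (\<exists>i. hub (e i) = hub (e (i + n)))"] that n_def by blast
  have dist: "l = l'" if "l < n" "l' < n" "hub (e (i + l)) = hub (e (i + l'))" for l l'
  proof (rule ccontr)
    assume "l \<noteq> l'"
    then consider "l < l'" | "l' < l" by linarith
    then show False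
      using least [of "l' - l" "i + l"] least [of "l - l'" "i + l'"] that by cases (auto simp: less_imp_diff_less)
  qed
  define v where "v t = (if even t then e (i + t div 2) else mate (e (i + t div 2)))" for t
  have vev: "v (2 * t) = e (i + t)" and vod: "v (2 * t + 1) = mate (e (i + t))" for t
    by (simp_all add: v_def)
  have ne: "e (i + l) \<noteq> mate (e (i + l'))" if l: "l < n" "l' < n" for l l'
  proof
    assume eq: "e (i + l) = mate (e (i + l'))"
    then have h: "hub (e (i + l)) = hub (e (i + Suc l'))" using hubS by simp
    show False
    proof (cases "Suc l' < n")
      case True
      then have "l = Suc l'" using dist l h by blast
      then show False using eq neS by simp
    next
      case False
      then have n': "n = Suc l'" using l by simp
      then have "l = 0" using dist [of l 0] l h n by simp
      \<comment> \<open>The last thread would be the first one traversed backwards.\<close>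
      then have e0: "mate (e i) = e (i + l')" using eq mate(2) sub eS by (metis Nat.add_0_right subsetD)
      then have h1: "hub (e (i + 1)) = hub (e (i + l'))" using hubS [of i] by simp
      consider "n = 1" | "n = 2" | "2 < n" using n by linarith
      then show False
      proof cases
        case 1
        then show False using e0 n' C [of "e i"] eS sub by auto
      next
        case 2
        then show False using e0 n' neS [of i] by simp
      next
        case 3
        then show False using dist [OF _ _ h1] n' by simp
      qed
    qed
  qed
  have inj: "inj_on v {..<2 * n}"
  proof (rule inj_onI)
    fix t t' assume t: "t \<in> {..<2 * n}" "t' \<in> {..<2 * n}" "v t = v t'"
    have lt: "t div 2 < n" "t' div 2 < n" using t by auto
    have mm: "mate (mate (e l)) = e l" for l using mate(2) eS sub by blast
    consider "even t" "even t'" | "odd t" "odd t'" | "even t" "odd t'" | "odd t" "even t'" by blast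
    then show "t = t'"
    proof cases
      case 1
      then have "t div 2 = t' div 2" using dist [OF lt] t(3) by (simp add: v_def)
      then show ?thesis using 1 by (metis dvd_mult_div_cancel)
    next
      case 2
      then have "e (i + t div 2) = e (i + t' div 2)" using t(3) mm by (metis v_def)
      then have "t div 2 = t' div 2" using dist [OF lt] by simp
      then show ?thesis using 2 by (metis odd_two_times_div_two_succ)
    next
      case 3
      then show ?thesis using ne [OF lt] t(3) by (simp add: v_def)
    next
      case 4
      then show ?thesis using ne [OF lt(2,1)] t(3) by (simp add: v_def)
    qed
  qed
  have vS: "v t \<in> ?ends middles" for t using eS mateS sub unfolding v_def by (metis subsetD)
  show thesis
  proof (rule that [of n v ctr hub mate])
    show "hub (v (2 * t + 1)) = hub (v (2 * t + 2))" for t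
    proof -
      have "v (2 * t + 2) = e (i + Suc t)" using vev [of "Suc t"] by simp
      then show ?thesis using hubS vod by simp
    qed
    show "hub (v 0) = hub (v (2 * n - 1))"
    proof -
      obtain n' where n': "n = Suc n'" using n by (cases n) auto
      then have "v (2 * n - 1) = mate (e (i + n'))" using vod [of n'] by simp
      then show ?thesis using hubS [of "i + n'"] n n' vev [of 0] by simp
    qed
    show "t = t'" if "t < n" "t' < n" "hub (v (2 * t)) = hub (v (2 * t'))" for t t'
      using dist that vev by simp
    show "mate (v (2 * t)) = v (2 * t + 1)" for t
      unfolding vev vod ..
    show "mate (v (2 * t + 1)) = v (2 * t)" for t
      unfolding vev vod using mate(2) eS sub by blast
  qed (use n inj C [OF vS] in \<open>auto simp: vev vod\<close>)
qed

text \<open>Uncolor the ends \<open>U\<close> and the middles \<open>C\<close> of the chain. An end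
  conflicts with its mate and with the other neighbors of its hub, at least one of which is in
  \<open>U\<close>; so at most \<open>k - 2\<close> colors are blocked from outside. Within
  \<open>U\<close> only cyclically consecutive ends conflict, which leaves an even cycle with two
  colors per vertex. The middles, of weight 2, are colored last.\<close>

lemma thread_cycle_reducible:
  assumes many: "card {v \<in> V. d v = k} < card middles"
    and L: "\<And>v. v \<in> V \<Longrightarrow> k \<le> card (L v)"
    and del: "\<And>e. e \<in> E \<Longrightarrow> \<exists>f. list_coloring_on (E - {e}) L V f"
  shows "\<exists>f. list_coloring_on E L V f"
proof -
  obtain n :: nat and v ctr hub mate where n: "0 < n" and inj: "inj_on v {..<2 * n}"
    and ctr: "\<And>t. ctr (v t) \<in> middles" and Nv: "\<And>t. N (v t) = {ctr (v t), hub (v t)}"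
    and hubk: "\<And>t. d (hub (v t)) = k" and Nctr: "\<And>t. N (ctr (v t)) = {v t, mate (v t)}"
    and mate: "\<And>t. mate (v (2 * t)) = v (2 * t + 1)" "\<And>t. mate (v (2 * t + 1)) = v (2 * t)"
    and hub: "\<And>t. hub (v (2 * t + 1)) = hub (v (2 * t + 2))" and hub0: "hub (v 0) = hub (v (2 * n - 1))"
    and hub_inj: "\<And>t t'. t < n \<Longrightarrow> t' < n \<Longrightarrow> hub (v (2 * t)) = hub (v (2 * t')) \<Longrightarrow> t = t'"
    using thread_cycle_exists [OF many] by (metis (no_types))
  define U where "U = v ` {..<2 * n}"
  define C where "C = ctr ` U"
  have finV: "finite V" using graph by (simp add: simple_graph_def)
  have dctr: "d (ctr (v t)) = 2" for t using ctr by (simp add: middles_def)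
  have ctr_hub: "ctr (v t) \<noteq> hub (v t')" for t t' using dctr [of t] hubk [of t'] k by auto
  have dv: "d (v t) = 2" for t using Nv ctr_hub by simp
  have vV: "v t \<in> V" for t using Nctr [of t] N_in_V by blast
  have CV: "C \<subseteq> V" using ctr unfolding C_def middles_def U_def by auto
  have UC: "U \<inter> C = {}"
  proof -
    have "v t \<noteq> ctr (v t')" for t t'
    proof
      assume "v t = ctr (v t')"
      then have "\<forall>x\<in>N (v t). d x = 2" using ctr [of t'] by (simp add: middles_def)
      then show False using Nv [of t] hubk [of t] k by simp
    qed
    then show ?thesis unfolding C_def U_def by auto
  qed
  have hub_same: "hub (v t') = hub (v t)" if "v t' \<in> N (hub (v t))" for t t'
    using that N_sym [of "v t'"] Nv [of t'] ctr_hub [of t' t] by auto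
  \<comment> \<open>The hubs are numbered by \<open>Suc t div 2\<close>. The end
    \<open>2 * n - 1\<close> gets the number \<open>n\<close>, outside the range of
    \<open>hub_inj\<close>, and is handled through \<open>hub0\<close>.\<close>
  have hub_half: "hub (v t) = hub (v (2 * (Suc t div 2)))" for t
  proof (cases "even t")
    case True
    then show ?thesis by (simp add: even_Suc_div_two)
  next
    case False
    then obtain l where "t = 2 * l + 1" by (rule oddE)
    then show ?thesis using hub [of l] by simp
  qed
  have hub_adj: "t' = Suc t \<or> t = 0 \<and> t' = 2 * n - 1"
    if t: "t < t'" "t' < 2 * n" "hub (v t) = hub (v t')" for t t'
  proof -
    have lt: "Suc t div 2 < n" using t by presburger
    show ?thesis
    proof (cases "t' = 2 * n - 1")
      case True
      then have "hub (v (2 * (Suc t div 2))) = hub (v (2 * 0))" using t(3) hub_half [of t] hub0 by simp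
      then have "Suc t div 2 = 0" using hub_inj [OF lt n] by blast
      then show ?thesis using True by presburger
    next
      case False
      then have "Suc t' div 2 < n" using t by presburger
      then have "Suc t div 2 = Suc t' div 2"
        using hub_inj [OF lt] t(3) hub_half [of t] hub_half [of t'] by metis
      then have "t' = Suc t" using t(1) by linarith
      then show ?thesis by simp
    qed
  qed
  have adj: "t' = Suc t mod (2 * n) \<or> t = Suc t' mod (2 * n)"
    if t: "t < 2 * n" "t' < 2 * n" "conflict E (v t) (v t')" for t t'
  proof -
    obtain w where w: "w \<in> N (v t)" "v t' \<in> N w" "v t \<noteq> v t'" using t(3) conflict_iff [of E "v t" "v t'"] by blast
    have "w = ctr (v t) \<or> w = hub (v t)" using w(1) Nv [of t] by simp
    then have "v t' = mate (v t) \<or> hub (v t) = hub (v t')"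
      using w(2,3) Nctr [of t] hub_same [of t' t] by auto
    then consider "v t' = mate (v t)" | "hub (v t) = hub (v t')" by blast
    then show ?thesis
    proof cases
      case 1
      show ?thesis
      proof (cases "even t")
        case True
        then obtain l where l: "t = 2 * l" by (rule evenE)
        then have "v t' = v (2 * l + 1)" "2 * l + 1 < 2 * n" using 1 mate(1) t by auto
        then have "t' = 2 * l + 1" using inj t(2) by (auto simp: inj_on_def)
        then show ?thesis using l t by simp
      next
        case False
        then obtain l where l: "t = 2 * l + 1" by (rule oddE)
        then have "v t' = v (2 * l)" "2 * l < 2 * n" using 1 mate(2) [of l] t by auto
        then have "t' = 2 * l" using inj t(2) by (auto simp: inj_on_def)
        then show ?thesis using l t by simp
      qed
    next
      case 2
      have "t \<noteq> t'" using w by auto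
      then consider "t < t'" | "t' < t" by linarith
      then show ?thesis
      proof cases
        case 1
        then show ?thesis using hub_adj [OF 1 t(2) 2] t n by auto
      next
        case 2
        then show ?thesis using hub_adj [OF 2 t(1)] \<open>hub (v t) = hub (v t')\<close> t n by auto
      qed
    qed
  qed
  have partner: "\<exists>t'. t' < 2 * n \<and> t' \<noteq> t \<and> hub (v t') = hub (v t)" if t: "t < 2 * n" for t
  proof -
    consider "t = 0" | "t = 2 * n - 1" | l where "t = 2 * l + 1" "2 * l + 2 < 2 * n" | l where "t = 2 * l + 2"
    proof (cases "even t")
      case True
      then obtain l where "t = 2 * l" by (rule evenE)
      then show thesis using that(1) that(4) [of "l - 1"] by (cases l) auto
    next
      case False
      then obtain l where l: "t = 2 * l + 1" by (rule oddE)
      then show thesis using that(2) that(3) [of l] t by (cases "2 * l + 2 < 2 * n") auto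
    qed
    then show ?thesis
    proof cases
      case 1
      then show ?thesis using hub0 n by (intro exI [of _ "2 * n - 1"]) auto
    next
      case 2
      then show ?thesis using hub0 n by (intro exI [of _ 0]) auto
    next
      case 3
      then show ?thesis using hub [of l] by (intro exI [of _ "2 * l + 2"]) auto
    next
      case 4
      then show ?thesis using hub [of l] t by (intro exI [of _ "2 * l + 1"]) auto
    qed
  qed
  have mateU: "mate (v t) \<in> U" if t: "t < 2 * n" for t
  proof (cases "even t")
    case True
    then obtain l where "t = 2 * l" by (rule evenE)
    then show ?thesis using mate(1) [of l] t unfolding U_def by auto
  next
    case False
    then obtain l where "t = 2 * l + 1" by (rule oddE)
    then show ?thesis using mate(2) [of l] t unfolding U_def by auto
  qed
  \<comment> \<open>Both ends of the deleted edge belong to the set that is uncolored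
    anyway.\<close>
  have "{v 0, ctr (v 0)} \<in> E" using Nctr [of 0] by (auto simp: nbhd_def)
  then obtain f where "list_coloring_on (E - {{v 0, ctr (v 0)}}) L V f" using del by blast
  then have f': "list_coloring_on E L (V - {v 0, ctr (v 0)}) f" by (rule list_coloring_delete_edge)
  have "v 0 \<in> U" "ctr (v 0) \<in> C" using n by (auto simp: U_def C_def)
  then have f: "list_coloring_on E L (V - (U \<union> C)) f"
    by (intro list_coloring_on_subset [OF f']) blast
  define \<Lambda> where "\<Lambda> t = L (v t) - f ` ({u. conflict E (v t) u} \<inter> (V - (U \<union> C)))" for t
  have card_\<Lambda>: "2 \<le> card (\<Lambda> t)" if t: "t < 2 * n" for t
  proof -
    obtain t' where t': "t' < 2 * n" "t' \<noteq> t" "hub (v t') = hub (v t)" using partner [OF t] by blast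
    let ?X = "{u. conflict E (v t) u} \<inter> (V - (U \<union> C))"
    have "?X \<subseteq> N (hub (v t)) - {v t, v t'}"
    proof
      fix u assume u: "u \<in> ?X"
      then obtain w where w: "w \<in> N (v t)" "u \<in> N w" using conflict_iff [of E "v t" u] by blast
      have "v t \<in> U" "v t' \<in> U" using t t' by (auto simp: U_def)
      then have "u \<noteq> v t" "u \<noteq> v t'" "u \<noteq> mate (v t)" using u mateU [OF t] by auto
      moreover from this have "w \<noteq> ctr (v t)" using w Nctr [of t] by auto
      ultimately show "u \<in> N (hub (v t)) - {v t, v t'}" using w Nv [of t] by auto
    qed
    then have "card ?X \<le> card (N (hub (v t)) - {v t, v t'})" by (intro card_mono) auto
    also have "\<dots> = k - 2"
    proof -
      have "v t \<noteq> v t'" using inj t t' by (auto simp: inj_on_def)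
      moreover have "v t \<in> N (hub (v t))" "v t' \<in> N (hub (v t))"
        using Nv N_sym t'(3) by (metis insertI1 insert_commute)+
      ultimately show ?thesis using hubk [of t] by (simp add: card_Diff_subset)
    qed
    finally have X: "card ?X \<le> k - 2" .
    have "finite ?X" using finV by blast
    then have "card (L (v t)) - card (f ` ?X) \<le> card (\<Lambda> t)"
      unfolding \<Lambda>_def by (intro diff_card_le_card_Diff) auto
    moreover have "card (f ` ?X) \<le> card ?X" using \<open>finite ?X\<close> by (rule card_image_le)
    ultimately show ?thesis using X L [OF vV [of t]] k by linarith
  qed
  then obtain h where h: "\<And>t. t < 2 * n \<Longrightarrow> h t \<in> \<Lambda> t" "\<And>t. t < 2 * n \<Longrightarrow> h t \<noteq> h (Suc t mod (2 * n))"
    using even_cycle_list_coloring [OF n, of \<Lambda>] by blast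
  define g where "g w = (if w \<in> U then h (inv_into {..<2 * n} v w) else f w)" for w
  have gv: "g (v t) = h t" if "t < 2 * n" for t
    using that inj by (auto simp: g_def U_def)
  have gf: "g w = f w" if "w \<notin> U" for w using that by (simp add: g_def)
  have mixed: "g u \<noteq> g w" if "u \<in> U" "w \<in> V - (U \<union> C)" "conflict E u w" for u w
  proof -
    obtain t where t: "t < 2 * n" "u = v t" using \<open>u \<in> U\<close> by (auto simp: U_def)
    then have "f w \<notin> \<Lambda> t" using that by (auto simp: \<Lambda>_def)
    then show ?thesis using h(1) [OF t(1)] gv [OF t(1)] gf that t by auto
  qed
  have "list_coloring_on E L ((V - (U \<union> C)) \<union> U) g"
    unfolding list_coloring_on_def
  proof (intro conjI ballI impI)
    show "g u \<in> L u" if "u \<in> (V - (U \<union> C)) \<union> U" for u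
    proof (cases "u \<in> U")
      case True
      then obtain t where t: "t < 2 * n" "u = v t" by (auto simp: U_def)
      then show ?thesis using h(1) [of t] gv by (auto simp: \<Lambda>_def)
    next
      case False
      then show ?thesis using that f gf unfolding list_coloring_on_def by auto
    qed
    show "g u \<noteq> g w" if uw: "u \<in> (V - (U \<union> C)) \<union> U" "w \<in> (V - (U \<union> C)) \<union> U" "conflict E u w" for u w
    proof -
      consider "u \<in> U" "w \<in> U" | "u \<in> U" "w \<notin> U" | "u \<notin> U" "w \<in> U" | "u \<notin> U" "w \<notin> U" by blast
      then show ?thesis
      proof cases
        case 1
        then obtain t t' where t: "t < 2 * n" "u = v t" "t' < 2 * n" "w = v t'" by (auto simp: U_def)
        then show ?thesis using adj [of t t'] h(2) [of t] h(2) [of t'] gv uw(3) by fastforce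
      next
        case 2
        then show ?thesis using mixed uw by blast
      next
        case 3
        then show ?thesis using mixed [of w u] uw conflict_sym by fastforce
      next
        case 4
        then show ?thesis using uw f gf unfolding list_coloring_on_def by auto
      qed
    qed
  qed
  moreover have "finite C" by (simp add: C_def U_def)
  moreover have "q m < card (L m)" if "m \<in> C" for m
  proof -
    have "q m = 2" using that middle_weight ctr by (auto simp: C_def U_def)
    then show ?thesis using L [of m] that CV k by fastforce
  qed
  ultimately have "\<exists>g. list_coloring_on E L (C \<union> ((V - (U \<union> C)) \<union> U)) g"
    using list_coloring_extend_set [OF graph] by blast
  moreover have "C \<union> ((V - (U \<union> C)) \<union> U) = V" using CV vV unfolding U_def by auto
  ultimately show ?thesis by simp
qed

end

text \<open>The common consequence of the two hypotheses, \<open>mad\<close> and planarity with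
  girth; it passes to subgraphs directly.\<close>

definition sparse_graph :: "real \<Rightarrow> 'a set \<Rightarrow> 'a set set \<Rightarrow> bool" where
  "sparse_graph r V E \<longleftrightarrow>
     (\<forall>W F. subgraph_of W F V E \<and> W \<noteq> {} \<longrightarrow> 2 * real (card F) < r * real (card W))"

lemma subgraph_of_trans:
  assumes "subgraph_of W F V E" "subgraph_of W' F' W F"
  shows "subgraph_of W' F' V E"
proof -
  have "W' \<subseteq> V" "F' \<subseteq> E" "\<forall>e\<in>F'. e \<subseteq> W'" using assms by (auto simp: subgraph_of_def)
  then show ?thesis by (simp add: subgraph_of_def)
qed

lemma simple_subgraph:
  assumes "simple_graph V E" "subgraph_of W F V E"
  shows "simple_graph W F"
proof -
  have "finite W"
    using assms finite_subset [of W V] by (simp add: simple_graph_def subgraph_of_def)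
  moreover have "e \<subseteq> W \<and> card e = 2" if "e \<in> F" for e
    using that assms by (auto simp: simple_graph_def subgraph_of_def)
  ultimately show ?thesis unfolding simple_graph_def by blast
qed

lemma nbhd_mono: "F \<subseteq> E \<Longrightarrow> nbhd F v \<subseteq> nbhd E v"
  unfolding nbhd_def by blast

text \<open>The bound \<open>k\<close> stays fixed while the maximum degree may drop in subgraphs;
  with degrees only bounded by \<open>k\<close>, the statement carries itself through the
  induction.\<close>

lemma sparse_graph_list_coloring:
  fixes V :: "'a set"
  assumes "simple_graph V E" and k: "6 \<le> k" and "\<forall>v\<in>V. card (nbhd E v) \<le> k"
    and "sparse_graph (2 + (4 * real k - 8) / (5 * real k + 2)) V E"
    and "\<forall>v\<in>V. k \<le> card (L v)"
  shows "\<exists>f. list_coloring_on E L V f"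
  using assms(1,3-)
proof (induction "card V + card E" arbitrary: V E rule: less_induct)
  case less
  note G = less.prems(1) and deg = less.prems(2) and sp = less.prems(3) and L = less.prems(4)
  have finV: "finite V" using G by (simp add: simple_graph_def)
  have finE: "finite E" by (rule simple_graph_finite_edges [OF G])
  have IH: "\<exists>f. list_coloring_on F L W f"
    if sub: "subgraph_of W F V E" and less': "card W + card F < card V + card E" for W F
  proof (rule less.hyps [OF less'])
    show "simple_graph W F" using simple_subgraph [OF G sub] .
    show "\<forall>v\<in>W. card (nbhd F v) \<le> k"
    proof
      fix v assume "v \<in> W"
      then have "v \<in> V" "F \<subseteq> E" using sub by (auto simp: subgraph_of_def)
      then have "card (nbhd F v) \<le> card (nbhd E v)"
        using finite_nbhd [OF G] nbhd_mono by (intro card_mono)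
      then show "card (nbhd F v) \<le> k" using deg \<open>v \<in> V\<close> by fastforce
    qed
    show "sparse_graph (2 + (4 * real k - 8) / (5 * real k + 2)) W F"
      using sp subgraph_of_trans [OF sub] unfolding sparse_graph_def by blast
    show "\<forall>v\<in>W. k \<le> card (L v)" using L sub by (auto simp: subgraph_of_def)
  qed
  have del: "\<exists>f. list_coloring_on (E - {e}) L V f" if "e \<in> E" for e
  proof (rule IH)
    show "subgraph_of V (E - {e}) V E"
      using G unfolding subgraph_of_def simple_graph_def by blast
    show "card V + card (E - {e}) < card V + card E"
      using card_Diff1_less [OF finE that] by simp
  qed
  show ?case
  proof (rule ccontr)
    assume no: "\<not> ?case"
    have "V \<noteq> {}" using no unfolding list_coloring_on_def by auto
    interpret sparse_configuration V E k
    proof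
      show "card (nbhd E v) \<le> k" if "v \<in> V" for v using deg that by blast
      show "2 \<le> card (nbhd E v)" if v: "v \<in> V" for v
      proof (rule ccontr)
        assume "\<not> 2 \<le> card (nbhd E v)"
        then have one: "a = b" if "a \<in> nbhd E v" "b \<in> nbhd E v" for a b
          using card_le_Suc0_iff_eq [OF finite_nbhd [OF G], of v] that by auto
        have "\<exists>f. list_coloring_on {e \<in> E. v \<notin> e} L (V - {v}) f"
        proof (rule IH)
          show "subgraph_of (V - {v}) {e \<in> E. v \<notin> e} V E"
            using G unfolding subgraph_of_def simple_graph_def by blast
          have "card {e \<in> E. v \<notin> e} \<le> card E" using finE by (intro card_mono) auto
          then show "card (V - {v}) + card {e \<in> E. v \<notin> e} < card V + card E"
            using card_Diff1_less [OF finV v] by linarith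
        qed
        then obtain f where f: "list_coloring_on {e \<in> E. v \<notin> e} L (V - {v}) f" by blast
        \<comment> \<open>With at most one neighbor, \<open>v\<close> is a common neighbor of no two
          vertices, so its removal loses no conflict between others.\<close>
        have "conflict {e \<in> E. v \<notin> e} a b" if ab: "conflict E a b" "a \<noteq> v" "b \<noteq> v" for a b
        proof -
          obtain w where w: "a \<noteq> b" "a \<in> nbhd E w" "b \<in> nbhd E w" using ab(1) by (auto simp: conflict_def)
          then have "w \<noteq> v" using one by blast
          then show ?thesis using w ab unfolding conflict_def nbhd_def by auto
        qed
        then have "list_coloring_on E L (V - {v}) f" using f unfolding list_coloring_on_def by blast
        moreover have "weight E v < card (L v)"
        proof -
          have "weight E v \<le> (\<Sum>u\<in>nbhd E v. k - 1)"
            unfolding weight_def using deg nbhd_subset [OF G] by (intro sum_mono diff_le_mono) blast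
          also have "\<dots> \<le> k - 1" using \<open>\<not> 2 \<le> card (nbhd E v)\<close>
            by (cases "card (nbhd E v) = 0") (auto simp: not_le less_2_cases_iff)
          also have "\<dots> < card (L v)" using L v k by fastforce
          finally show ?thesis .
        qed
        ultimately have "\<exists>g. list_coloring_on E L (insert v (V - {v})) g"
          by (rule list_coloring_extend [OF G])
        then show False using no v by (simp add: insert_absorb)
      qed
      show "k \<le> weight E u \<or> k \<le> weight E v" if uv: "u \<in> nbhd E v" for u v
      proof (rule ccontr)
        assume light: "\<not> ?thesis"
        have "{u, v} \<in> E" using uv by (simp add: nbhd_def)
        then obtain f where "list_coloring_on (E - {{u, v}}) L V f" using del by blast
        then have f: "list_coloring_on E L (V - {u, v}) f" by (rule list_coloring_delete_edge)
        have uvV: "{u, v} \<subseteq> V" using \<open>{u, v} \<in> E\<close> G by (auto simp: simple_graph_def)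
        have "\<exists>g. list_coloring_on E L ({u, v} \<union> (V - {u, v})) g"
        proof (rule list_coloring_extend_set [OF G _ f])
          show "weight E w < card (L w)" if "w \<in> {u, v}" for w
            using that light L uvV by fastforce
        qed simp
        moreover have "{u, v} \<union> (V - {u, v}) = V" using uvV by blast
        ultimately show False using no by simp
      qed
    qed (use G k in auto)
    show False
    proof (cases "card middles \<le> card {v \<in> V. card (nbhd E v) = k}")
      case True
      have "subgraph_of V E V E" using G by (auto simp: subgraph_of_def simple_graph_def)
      then have "2 * real (card E) < (2 + (4 * real k - 8) / (5 * real k + 2)) * real (card V)"
        using sp \<open>V \<noteq> {}\<close> unfolding sparse_graph_def by blast
      then show False using average_degree_ge True unfolding middles_def by linarith
    next
      case False
      then have "\<exists>f. list_coloring_on E L V f"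
        using thread_cycle_reducible [of L] L del by (simp add: not_le)
      then show False using no by blast
    qed
  qed
qed

section \<open>From list colorings to the choice number\<close>

lemma max_degree_properties:
  assumes "simple_graph V E"
  shows "v \<in> V \<Longrightarrow> card (nbhd E v) \<le> max_degree V E"
    and "max_degree V E \<noteq> 0 \<Longrightarrow> \<exists>v\<in>V. card (nbhd E v) = max_degree V E"
proof -
  have eq: "max_degree V E = Max (insert 0 ((\<lambda>v. card (nbhd E v)) ` V))"
    using vertex_degree_eq [OF assms] unfolding max_degree_def by simp
  have fin: "finite (insert 0 ((\<lambda>v. card (nbhd E v)) ` V))"
    using assms by (simp add: simple_graph_def)
  show "v \<in> V \<Longrightarrow> card (nbhd E v) \<le> max_degree V E"
    unfolding eq using fin by (intro Max_ge) auto
  show "max_degree V E \<noteq> 0 \<Longrightarrow> \<exists>v\<in>V. card (nbhd E v) = max_degree V E"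
    using Max_in [OF fin] unfolding eq by auto
qed

text \<open>The neighbors of a vertex of maximum degree conflict pairwise, so identical lists of
  \<open>k\<close> colors suffice only if there are at most \<open>k\<close> of them.\<close>

lemma max_degree_le_of_choosable:
  assumes G: "simple_graph V E" and ch: "injectively_choosable V E k"
  shows "max_degree V E \<le> k"
proof (cases "max_degree V E = 0")
  case False
  then obtain v where v: "v \<in> V" "card (nbhd E v) = max_degree V E"
    using max_degree_properties(2) [OF G] by blast
  obtain f where f: "injective_coloring V E f" "\<forall>v\<in>V. f v \<in> {..<k}"
    using ch [unfolded injectively_choosable_def, rule_format, of "\<lambda>_. {..<k}"] by auto
  have sub: "nbhd E v \<subseteq> V" by (rule nbhd_subset [OF G])
  have "inj_on f (nbhd E v)"
    using f(1) sub unfolding injective_coloring_iff [OF G] conflict_def inj_on_def by blast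
  then have "card (nbhd E v) \<le> card {..<k}"
    using f(2) sub by (intro card_inj_on_le) auto
  then show ?thesis using v by simp
qed simp

theorem injective_choice_number_sparse:
  assumes G: "simple_graph V E" and k: "6 \<le> max_degree V E"
    and sp: "sparse_graph (2 + (4 * real (max_degree V E) - 8) / (5 * real (max_degree V E) + 2)) V E"
  shows "injective_choice_number V E = max_degree V E"
proof -
  let ?k = "max_degree V E"
  have "injectively_choosable V E ?k"
    unfolding injectively_choosable_def
  proof (intro allI impI)
    fix L :: "'a \<Rightarrow> nat set"
    assume L: "\<forall>v\<in>V. infinite (L v) \<or> ?k \<le> card (L v)"
    \<comment> \<open>Infinite lists have cardinality 0, so all lists are first cut down to exactly
      \<open>?k\<close> colors.\<close>
    have "\<forall>v\<in>V. \<exists>T. T \<subseteq> L v \<and> card T = ?k"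
      using L by (metis infinite_arbitrarily_large obtain_subset_with_card_n)
    then obtain T where T: "\<And>v. v \<in> V \<Longrightarrow> T v \<subseteq> L v" "\<And>v. v \<in> V \<Longrightarrow> card (T v) = ?k" by metis
    obtain f where f: "list_coloring_on E T V f"
      using sparse_graph_list_coloring [OF G k _ sp, of T] max_degree_properties(1) [OF G] T(2) by auto
    then show "\<exists>f. injective_coloring V E f \<and> (\<forall>v\<in>V. f v \<in> L v)"
      unfolding list_coloring_on_def injective_coloring_iff [OF G] using T(1) by blast
  qed
  then show ?thesis
    unfolding injective_choice_number_def
    by (rule Least_equality) (rule max_degree_le_of_choosable [OF G])
qed

lemma sparse_graph_of_mad:
  assumes G: "simple_graph V E" and mad: "mad V E < r"
  shows "sparse_graph r V E"
  unfolding sparse_graph_def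
proof (intro allI impI)
  fix W F assume WF: "subgraph_of W F V E \<and> W \<noteq> {}"
  have fin: "finite V" "finite E" using G simple_graph_finite_edges by (auto simp: simple_graph_def)
  let ?f = "\<lambda>(W, F). 2 * real (card F) / real (card W)"
  have "{2 * real (card F) / real (card W) | W F. subgraph_of W F V E \<and> W \<noteq> {}} \<subseteq> ?f ` (Pow V \<times> Pow E)"
    unfolding subgraph_of_def by (force simp: image_iff)
  then have "finite {2 * real (card F) / real (card W) | W F. subgraph_of W F V E \<and> W \<noteq> {}}"
    using fin finite_subset by blast
  then have "2 * real (card F) / real (card W) \<le> mad V E"
    unfolding mad_def using WF by (intro Max_ge) auto
  then have "2 * real (card F) / real (card W) < r" using mad by simp
  moreover have "finite W" using WF fin finite_subset unfolding subgraph_of_def by blast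
  then have "0 < card W" using WF by (simp add: card_gt_0_iff)
  ultimately show "2 * real (card F) < r * real (card W)" by (simp add: divide_less_eq)
qed

section \<open>Sparsity of planar graphs of large girth\<close>

lemma graph_cycle_subgraph:
  assumes "subgraph_of W F V E" "graph_cycle W F vs"
  shows "graph_cycle V E vs"
proof -
  have "W \<subseteq> V" "F \<subseteq> E" using assms(1) by (auto simp: subgraph_of_def)
  then show ?thesis using assms(2) unfolding graph_cycle_def by blast
qed

text \<open>Every subgraph inherits the drawing and the girth bound, so the face count applies to
  each of them.\<close>

lemma sparse_graph_of_planar:
  fixes g :: real
  assumes G: "simple_graph V E" and "planar_graph V E" and g: "2 < g"
    and girth: "ereal g \<le> ereal_of_enat (girth V E)"
  shows "sparse_graph (2 * g / (g - 2)) V E"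
  unfolding sparse_graph_def
proof (intro allI impI)
  fix W F assume WF: "subgraph_of W F V E \<and> W \<noteq> {}"
  obtain p \<gamma> where emb: "plane_embedding V E p \<gamma>" using assms(2) unfolding planar_graph_def by blast
  interpret plane_drawing W F p \<gamma>
  proof
    show "simple_graph W F" using simple_subgraph [OF G] WF by blast
    have sub: "W \<subseteq> V" "F \<subseteq> E" "\<And>e. e \<in> F \<Longrightarrow> e \<subseteq> W" using WF by (auto simp: subgraph_of_def)
    have Int_restrict: "A \<inter> D = B" if "A \<inter> C = B" "D \<subseteq> C" "B \<subseteq> D" for A B C D :: "complex set"
      using that by blast
    have inj: "inj_on p V"
      and edge: "\<And>e. e \<in> E \<Longrightarrow> arc (\<gamma> e) \<and> {pathstart (\<gamma> e), pathfinish (\<gamma> e)} = p ` e \<and>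
        path_image (\<gamma> e) \<inter> p ` V = p ` e"
      and meet: "\<And>e e'. e \<in> E \<Longrightarrow> e' \<in> E \<Longrightarrow> e \<noteq> e' \<Longrightarrow>
        path_image (\<gamma> e) \<inter> path_image (\<gamma> e') \<subseteq> p ` (e \<inter> e')"
      using emb by (auto simp: plane_embedding_def)
    show "plane_embedding W F p \<gamma>"
      unfolding plane_embedding_def
    proof (intro conjI ballI impI)
      show "inj_on p W" using inj sub(1) by (rule inj_on_subset)
      fix e assume e: "e \<in> F"
      then have eE: "e \<in> E" using sub(2) by blast
      show "arc (\<gamma> e)" "{pathstart (\<gamma> e), pathfinish (\<gamma> e)} = p ` e" using edge [OF eE] by blast+
      have "path_image (\<gamma> e) \<inter> p ` V = p ` e" using edge [OF eE] by blast
      then show "path_image (\<gamma> e) \<inter> p ` W = p ` e"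
        by (rule Int_restrict [OF _ image_mono [OF sub(1)] image_mono [OF sub(3) [OF e]]])
      show "path_image (\<gamma> e) \<inter> path_image (\<gamma> e') \<subseteq> p ` (e \<inter> e')" if "e' \<in> F" "e \<noteq> e'" for e'
        using meet [OF eE _ that(2)] sub(2) that(1) by blast
    qed
  qed
  have "g \<le> length vs" if "graph_cycle W F vs" for vs
  proof -
    have "graph_cycle V E vs" using graph_cycle_subgraph [OF _ that] WF by blast
    then have "girth V E \<le> enat (length vs)" unfolding girth_def by (intro INF_lower) simp
    then have "ereal_of_enat (girth V E) \<le> ereal_of_enat (enat (length vs))"
      by (simp only: ereal_of_enat_le_iff)
    then have "ereal g \<le> ereal (length vs)" using girth by (metis ereal_of_enat_simps(1) order_trans)
    then show ?thesis by simp
  qed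
  then have "(g - 2) * card F < g * card W" using edges_le_girth_bound [of g] WF g by blast
  then show "2 * real (card F) < 2 * g / (g - 2) * real (card W)" using g by (simp add: field_simps)
qed

theorem mainTheorem2:
  fixes V :: "'a set" and E :: "'a set set" and \<Delta> :: nat
  assumes "simple_graph V E" and "\<Delta> = max_degree V E" and "\<Delta> \<ge> 6"
  shows "(mad V E < 2 + (4 * real \<Delta> - 8) / (5 * real \<Delta> + 2)
            \<longrightarrow> injective_choice_number V E = \<Delta>) \<and>
         (planar_graph V E \<and> ereal_of_enat (girth V E) \<ge> ereal (7 + 12 / (real \<Delta> - 2))
            \<longrightarrow> injective_choice_number V E = \<Delta>)"
proof (intro conjI impI)
  have *: "injective_choice_number V E = \<Delta>"
    if "sparse_graph (2 + (4 * real \<Delta> - 8) / (5 * real \<Delta> + 2)) V E"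
    using injective_choice_number_sparse [of V E] that assms by simp
  show "injective_choice_number V E = \<Delta>" if "mad V E < 2 + (4 * real \<Delta> - 8) / (5 * real \<Delta> + 2)"
    by (rule * [OF sparse_graph_of_mad [OF assms(1) that]])
  show "injective_choice_number V E = \<Delta>"
    if pl: "planar_graph V E \<and> ereal_of_enat (girth V E) \<ge> ereal (7 + 12 / (real \<Delta> - 2))"
  proof (rule *)
    define g where "g = 7 + 12 / (real \<Delta> - 2)"
    have "2 < g" using assms(3) by (simp add: g_def add_pos_nonneg)
    \<comment> \<open>The origin of the girth bound:
      \<open>2 * g / (g - 2) = 2 + 4 / (g - 2)\<close>, and
      \<open>g - 2 = (5 * \<Delta> + 2) / (\<Delta> - 2)\<close> turns this into exactly the average
      degree bound.\<close>
    have "2 + (4 * real \<Delta> - 8) / (5 * real \<Delta> + 2) = 2 * g / (g - 2)"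
    proof -
      have "0 < real \<Delta> - 2" "0 < 5 * real \<Delta> + 2" using assms(3) by auto
      then have "g - 2 = (5 * real \<Delta> + 2) / (real \<Delta> - 2)" by (simp add: g_def field_simps)
      then have "4 / (g - 2) = (4 * real \<Delta> - 8) / (5 * real \<Delta> + 2)" by simp
      moreover have "2 * g / (g - 2) = 2 + 4 / (g - 2)" using \<open>2 < g\<close> by (simp add: field_simps)
      ultimately show ?thesis by simp
    qed
    moreover have "sparse_graph (2 * g / (g - 2)) V E"
    proof (rule sparse_graph_of_planar [OF assms(1) _ \<open>2 < g\<close>])
      show "planar_graph V E" using pl by blast
      show "ereal g \<le> ereal_of_enat (girth V E)" using pl unfolding g_def by blast
    qed
    ultimately show "sparse_graph (2 + (4 * real \<Delta> - 8) / (5 * real \<Delta> + 2)) V E" by simp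
  qed
qed

end
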